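(* Let $0<a<1$ and let $C_a$ be the Chebyshev's method of $p_a(z)=(z^2-1)(z^2-a)$. At least two of the four immediate basins of attraction of $C_a$ corresponding to the roots of $p_a$ are simply connected.
   Context: For a polynomial $p$, the Chebyshev's method of $p$ is the rational map $C_p(z)=z-\left[1+\frac12 L_p(z)\right]\frac{p(z)}{p'(z)}$ with $L_p(z)=\frac{p(z)p''(z)}{(p'(z))^2}$, regarded as a self-map of the Riemann sphere $\widehat{\mathbb C}$. For $p_a(z)=(z^2-1)(z^2-a)$ write $C_a:=C_{p_a}$. The roots $-1,-\sqrt a,\sqrt a,1$ of $p_a$ are superattracting fixed points of $C_a$; the immediate basin of attraction corresponding to a root $\zeta$ is the Fatou component of $C_a$ (connected component of the set of normality of $\{C_a^n\}_{n>0}$) containing $\zeta$. *)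

theory Defs
  imports
    "HOL-Analysis.Analysis"
    "HOL-Computational_Algebra.Computational_Algebra"
    "HOL-Computational_Algebra.Field_as_Ring"
begin

section \<open>The Riemann sphere\<close>

datatype riemann_sphere = Fin complex | Infty

text \<open>Inverse stereographic projection onto the Euclidean unit sphere of \<open>\<complex> \<times> \<real>\<close>;
  it induces the chordal metric.\<close>

fun stereo :: "riemann_sphere \<Rightarrow> complex \<times> real" where
  "stereo (Fin z) = ((2 / (1 + (cmod z)\<^sup>2)) *\<^sub>R z, ((cmod z)\<^sup>2 - 1) / ((cmod z)\<^sup>2 + 1))"
| "stereo Infty = (0, 1)"

lemma inj_stereo: "inj stereo"
proof (rule injI)
  fix x y assume eq: "stereo x = stereo y"
  have pos: "1 + (cmod z)\<^sup>2 > 0" for z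
    by (simp add: add_pos_nonneg)
  have snd_stereo: "snd (stereo (Fin z)) = 1 - 2 / (1 + (cmod z)\<^sup>2)" for z
    using pos[of z] by (simp add: field_simps)
  show "x = y"
  proof (cases x; cases y)
    fix z w assume xy: "x = Fin z" "y = Fin w"
    have "2 / (1 + (cmod z)\<^sup>2) = 2 / (1 + (cmod w)\<^sup>2)"
      using eq snd_stereo[of z] snd_stereo[of w] xy by simp
    with eq xy pos[of w] show ?thesis by auto
  next
    fix z assume xy: "x = Fin z" "y = Infty"
    then have "2 / (1 + (cmod z)\<^sup>2) = 0" using eq snd_stereo[of z] by simp
    with pos[of z] show ?thesis by simp
  next
    fix z assume xy: "x = Infty" "y = Fin z"
    then have "2 / (1 + (cmod z)\<^sup>2) = 0" using eq snd_stereo[of z] by simp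
    with pos[of z] show ?thesis by simp
  qed simp
qed

instantiation riemann_sphere :: metric_space
begin

definition dist_riemann_sphere :: "riemann_sphere \<Rightarrow> riemann_sphere \<Rightarrow> real" where
  "dist_riemann_sphere x y = dist (stereo x) (stereo y)"

definition uniformity_riemann_sphere :: "(riemann_sphere \<times> riemann_sphere) filter" where
  "uniformity_riemann_sphere = (INF e\<in>{0<..}. principal {(x, y). dist x y < e})"

definition open_riemann_sphere :: "riemann_sphere set \<Rightarrow> bool" where
  "open_riemann_sphere U \<longleftrightarrow>
     (\<forall>x\<in>U. eventually (\<lambda>(x', y). x' = x \<longrightarrow> y \<in> U) uniformity)"

instance
  by standard
     (auto simp: dist_riemann_sphere_def uniformity_riemann_sphere_def open_riemann_sphere_def
        inj_eq[OF inj_stereo] dist_triangle2)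

end


section \<open>Rational maps\<close>

text \<open>The self-map of the sphere induced by a rational function. The pair obtained from
  \<^const>\<open>quot_of_fract\<close> is coprime, so numerator and denominator have no common zero, and
  \<open>coeff P (degree Q)\<close> vanishes if \<open>degree P < degree Q\<close>.\<close>

definition rational_map :: "complex poly fract \<Rightarrow> riemann_sphere \<Rightarrow> riemann_sphere" where
  "rational_map R x =
     (case quot_of_fract R of (P, Q) \<Rightarrow>
       (case x of
          Fin z \<Rightarrow> if poly Q z = 0 then Infty else Fin (poly P z / poly Q z)
        | Infty \<Rightarrow> if degree P > degree Q then Infty
                   else Fin (coeff P (degree Q) / lead_coeff Q)))"

definition chebyshev_L :: "complex poly \<Rightarrow> complex poly fract" where
  "chebyshev_L p = to_fract p * to_fract (pderiv (pderiv p)) / (to_fract (pderiv p))\<^sup>2"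

definition chebyshev_fract :: "complex poly \<Rightarrow> complex poly fract" where
  "chebyshev_fract p =
     to_fract [:0, 1:] - (1 + 1/2 * chebyshev_L p) * (to_fract p / to_fract (pderiv p))"

definition chebyshev_method :: "complex poly \<Rightarrow> riemann_sphere \<Rightarrow> riemann_sphere" where
  "chebyshev_method p = rational_map (chebyshev_fract p)"


section \<open>Normality, Fatou set and immediate basins\<close>

definition normal_family_on ::
    "('a::metric_space \<Rightarrow> 'b::metric_space) set \<Rightarrow> 'a set \<Rightarrow> bool" where
  "normal_family_on F U \<longleftrightarrow>
     (\<forall>s::nat \<Rightarrow> 'a \<Rightarrow> 'b. range s \<subseteq> F \<longrightarrow>
        (\<exists>(r::nat \<Rightarrow> nat) g. strict_mono r \<and>
           (\<forall>K. compact K \<and> K \<subseteq> U \<longrightarrow> uniform_limit K (s \<circ> r) g sequentially)))"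

definition fatou_set :: "('a::metric_space \<Rightarrow> 'a) \<Rightarrow> 'a set" where
  "fatou_set f = {x. \<exists>U. open U \<and> x \<in> U \<and> normal_family_on {f ^^ n |n. n > 0} U}"

definition immediate_basin :: "('a::metric_space \<Rightarrow> 'a) \<Rightarrow> 'a \<Rightarrow> 'a set" where
  "immediate_basin f x = connected_component_set (fatou_set f) x"


section \<open>The quartic family\<close>

definition quartic :: "complex \<Rightarrow> complex poly" where
  "quartic a = ([:0, 1:]\<^sup>2 - 1) * ([:0, 1:]\<^sup>2 - [:a:])"

end

theory Submission
  imports Defs "HOL-Complex_Analysis.Complex_Analysis"
begin

text \<open>Let \<open>\<zeta>\<close> be an attracting fixed point and \<open>B\<close> a small disc around it. The Fatou component of
  \<open>\<zeta>\<close> is the component of \<open>\<zeta>\<close> in its basin, and it is exhausted by the components \<open>W\<^sub>n\<close> of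
  \<open>C\<^sup>-\<^sup>n(B)\<close> containing \<open>\<zeta>\<close>. The map \<open>C\<^sup>n : W\<^sub>n \<rightarrow> B\<close> is proper; if \<open>\<zeta>\<close> is the only critical point in
  the basin, then it is a covering away from the fibre over \<open>\<zeta>\<close>, so the radial contraction of \<open>B\<close>
  lifts and shrinks \<open>W\<^sub>n\<close> into a small disc; hence \<open>W\<^sub>n\<close> is contractible.

  The critical points of \<open>C\<^sub>a\<close> other than roots and poles are the four solutions of
  \<open>28 z\<^sup>4 - 8 (1 + a) z\<^sup>2 + (1 + a)\<^sup>2 = 0\<close>, which have the form \<open>\<plusminus>c\<close>, \<open>\<plusminus>cnj c\<close>. As \<open>C\<^sub>a\<close> commutes with
  negation and conjugation, the basins of \<open>1\<close> and \<open>sqrt a\<close> cannot both meet this orbit. If the basin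
  of \<open>\<zeta>\<close> does not, neither does that of \<open>-\<zeta>\<close>, and both immediate basins are simply connected.\<close>

section \<open>Proper holomorphic maps onto a disc\<close>

text \<open>Fibres are compact by properness and discrete by local injectivity, hence finite. Small
  disjoint discs around the fibre points become sheets once the target neighbourhood avoids the
  image of everything outside them. Surjectivity follows since the image is open and closed in the
  connected set \<open>P\<close>.\<close>

lemma covering_space_proper_locally_biholomorphic:
  fixes f :: "complex \<Rightarrow> complex"
  assumes holf: "f holomorphic_on V" and V: "open V" "V \<noteq> {}"
    and P: "open P" "connected P" and fim: "f ` V \<subseteq> P"
    and proper: "\<And>K. compact K \<Longrightarrow> K \<subseteq> P \<Longrightarrow> compact (V \<inter> f -` K)"
    and crit: "\<And>z. z \<in> V \<Longrightarrow> deriv f z \<noteq> 0"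
  shows "covering_space V f P"
proof -
  have contf: "continuous_on V f"
    using holf by (rule holomorphic_on_imp_continuous_on)
  have locinv: "\<exists>e>0. ball z e \<subseteq> V \<and> inj_on f (ball z e)" if "z \<in> V" for z
    using has_complex_derivative_locally_injective[OF holf that V(1) crit[OF that]] by metis
  \<comment> \<open>Stated for every \<open>x\<close> in \<open>P\<close>, before surjectivity is
    known: over a point outside the image, the family \<open>v\<close> of sheets is empty.\<close>
  have even: "\<exists>T. x \<in> T \<and> open T \<and> T \<subseteq> P \<and>
      (\<exists>v. \<Union>v = V \<inter> f -` T \<and> (\<forall>u\<in>v. open u) \<and> pairwise disjnt v \<and>
           (\<forall>u\<in>v. \<exists>q. homeomorphism u T f q))" if x: "x \<in> P" for x
  proof -
    define \<Phi> where "\<Phi> = V \<inter> f -` {x}"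
    have comp\<Phi>: "compact \<Phi>"
      unfolding \<Phi>_def using proper[of "{x}"] x by auto
    have "\<not> z islimpt \<Phi>" if "z \<in> \<Phi>" for z
    proof -
      have "z \<in> V" using that by (simp add: \<Phi>_def)
      then obtain e where e: "e > 0" "inj_on f (ball z e)"
        using locinv by blast
      have "\<Phi> \<inter> ball z e \<subseteq> {z}"
        using e that unfolding \<Phi>_def inj_on_def by auto
      then have "finite (\<Phi> \<inter> ball z e)"
        by (rule finite_subset) simp
      then show ?thesis
        using e(1) by (metis islimpt_eq_infinite_ball)
    qed
    then have fin\<Phi>: "finite \<Phi>"
      using finite_not_islimpt_in_compact[OF comp\<Phi>, of \<Phi>] by simp
    have "\<exists>d>0. \<forall>z\<in>\<Phi>. ball z d \<subseteq> V \<and> inj_on f (ball z d)"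
    proof -
      obtain e where e: "\<And>z. z \<in> \<Phi> \<Longrightarrow> e z > 0 \<and> ball z (e z) \<subseteq> V \<and> inj_on f (ball z (e z))"
        using locinv unfolding \<Phi>_def by (metis IntE)
      \<comment> \<open>The inserted 1 keeps \<open>Min\<close> meaningful when the fibre is empty;
        the set \<open>A\<close> below contains 1 so that fibres with fewer than two points are
        covered.\<close>
      define d where "d = Min (insert 1 (e ` \<Phi>))"
      have "d > 0" unfolding d_def using fin\<Phi> e by auto
      moreover have "d \<le> e z" if "z \<in> \<Phi>" for z
        unfolding d_def using fin\<Phi> that by simp
      then have "ball z d \<subseteq> ball z (e z)" if "z \<in> \<Phi>" for z
        using that by (simp add: subset_ball)
      ultimately show ?thesis using e by (meson inj_on_subset subset_trans)
    qed
    then obtain d1 where d1: "d1 > 0" "\<And>z. z \<in> \<Phi> \<Longrightarrow> ball z d1 \<subseteq> V \<and> inj_on f (ball z d1)"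
      by blast
    obtain d2 where d2: "d2 > 0" "\<And>z w. z \<in> \<Phi> \<Longrightarrow> w \<in> \<Phi> \<Longrightarrow> z \<noteq> w \<Longrightarrow> d2 \<le> dist z w"
    proof -
      define A where "A = insert 1 ((\<lambda>(z,w). dist z w) ` {p \<in> \<Phi> \<times> \<Phi>. fst p \<noteq> snd p})"
      have finA: "finite A" unfolding A_def using fin\<Phi> by simp
      have "Min A > 0" using finA by (subst Min_gr_iff) (auto simp: A_def)
      moreover have "Min A \<le> dist z w" if "z \<in> \<Phi>" "w \<in> \<Phi>" "z \<noteq> w" for z w
        using finA by (rule Min_le) (use that in \<open>force simp: A_def\<close>)
      ultimately show ?thesis using that by blast
    qed
    define d where "d = min d1 (d2 / 2)"
    have d: "d > 0" "\<And>z. z \<in> \<Phi> \<Longrightarrow> ball z d \<subseteq> V \<and> inj_on f (ball z d)"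
      using d1 d2(1) unfolding d_def
      by (auto simp: inj_on_def subset_iff)
    have disj: "ball z d \<inter> ball w d = {}" if "z \<in> \<Phi>" "w \<in> \<Phi>" "z \<noteq> w" for z w
      using d2(2)[OF that] disjoint_ballI[of d d z w] by (simp add: d_def)
    have opim: "open (f ` U)" if "open U" "U \<subseteq> ball z d" "z \<in> \<Phi>" for U z
    proof (rule open_mapping_thm3)
      show "f holomorphic_on U"
        using d(2)[OF that(3)] that(2) holf holomorphic_on_subset by blast
      show "inj_on f U"
        using d(2)[OF that(3)] that(2) inj_on_subset by blast
    qed (rule that(1))
    obtain \<eta>0 where \<eta>0: "\<eta>0 > 0" "cball x \<eta>0 \<subseteq> P"
      using P(1) x open_contains_cball by blast
    \<comment> \<open>The points near the fibre level that escape all chosen discs. Properness makes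
      \<open>Z\<close> compact, so its image is closed; it misses \<open>x\<close> and can be cut
      out of \<open>T\<close>, which forces every preimage of \<open>T\<close> into one of the
      discs.\<close>
    define Z where "Z = (V \<inter> f -` cball x \<eta>0) - (\<Union>z\<in>\<Phi>. ball z d)"
    have "compact Z"
      unfolding Z_def using proper[OF _ \<eta>0(2)] by (intro compact_diff) auto
    then have "compact (f ` Z)"
      using contf by (intro compact_continuous_image) (auto simp: Z_def intro: continuous_on_subset)
    then have "open (- (f ` Z))"
      by (simp add: compact_imp_closed open_Compl)
    moreover have "x \<notin> f ` Z"
      using d(1) unfolding Z_def \<Phi>_def by force
    moreover have "open (\<Inter>z\<in>\<Phi>. f ` ball z d)"
      using fin\<Phi> opim by (intro open_INT) auto
    moreover have "x \<in> (\<Inter>z\<in>\<Phi>. f ` ball z d)"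
      using d(1) unfolding \<Phi>_def by force
    moreover define T where "T = - (f ` Z) \<inter> (\<Inter>z\<in>\<Phi>. f ` ball z d) \<inter> ball x \<eta>0"
    ultimately have T: "open T" "x \<in> T" "T \<subseteq> - (f ` Z)" "T \<subseteq> (\<Inter>z\<in>\<Phi>. f ` ball z d)"
       "T \<subseteq> ball x \<eta>0"
      using \<eta>0(1) by auto
    define v where "v = (\<lambda>z. ball z d \<inter> f -` T) ` \<Phi>"
    have openu: "open (ball z d \<inter> f -` T)" if "z \<in> \<Phi>" for z
      using continuous_open_preimage[OF continuous_on_subset[OF contf, of "ball z d"] _ T(1)]
        d(2)[OF that] by simp
    have "\<Union>v = V \<inter> f -` T"
    proof
      show "\<Union>v \<subseteq> V \<inter> f -` T"
        using d(2) by (auto simp: v_def)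
      show "V \<inter> f -` T \<subseteq> \<Union>v"
      proof
        fix y assume y: "y \<in> V \<inter> f -` T"
        then have "f y \<in> cball x \<eta>0" using T(5) by (auto simp: subset_iff less_imp_le)
        moreover have "y \<notin> Z" using T(3) y by auto
        ultimately have "y \<in> (\<Union>z\<in>\<Phi>. ball z d)" using y by (auto simp: Z_def)
        then show "y \<in> \<Union>v" using y by (auto simp: v_def)
      qed
    qed
    moreover have "\<forall>u\<in>v. open u"
      using openu by (auto simp: v_def)
    moreover have "pairwise disjnt v"
    proof (unfold pairwise_def v_def, clarsimp)
      fix z w assume zw: "z \<in> \<Phi>" "w \<in> \<Phi>" "ball z d \<inter> f -` T \<noteq> ball w d \<inter> f -` T"
      then have "z \<noteq> w" by auto
      then show "disjnt (ball z d \<inter> f -` T) (ball w d \<inter> f -` T)"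
        using disj[OF zw(1,2)] unfolding disjnt_def by blast
    qed
    moreover have "\<exists>q. homeomorphism u T f q" if u: "u \<in> v" for u
    proof -
      obtain z where z: "z \<in> \<Phi>" "u = ball z d \<inter> f -` T"
        using u by (auto simp: v_def)
      have "T \<subseteq> f ` ball z d"
        using T(4) z(1) by blast
      then have im: "f ` u = T"
        using z(2) by blast
      have opu: "open u" using openu z by simp
      show ?thesis
      proof (rule homeomorphism_injective_open_map[of u f T])
        show "continuous_on u f"
          using contf d(2)[OF z(1)] z(2) by (meson continuous_on_subset inf.coboundedI1)
        show "inj_on f u"
          using d(2)[OF z(1)] z(2) by (meson inf_le1 inj_on_subset)
        show "openin (top_of_set T) (f ` U)" if "openin (top_of_set u) U" for U
        proof -
          have "open U" "U \<subseteq> u"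
            using that opu openin_open_eq by blast+
          then have "open (f ` U)" using opim z by blast
          then show ?thesis
            using im \<open>U \<subseteq> u\<close> by (metis image_mono open_subset)
        qed
      qed (use im in auto)
    qed
    moreover have "T \<subseteq> P" using T(5) \<eta>0(2) ball_subset_cball by blast
    ultimately show ?thesis using T(1,2) by metis
  qed
  have im: "f ` V = P"
  proof -
    have "open (f ` V)"
    proof (subst open_subopen, safe)
      fix z assume z: "z \<in> V"
      then obtain r where r: "r > 0" "ball z r \<subseteq> V" "open (f ` ball z r)"
        using has_complex_derivative_locally_invertible[OF holf z V(1) crit[OF z]] by metis
      then show "\<exists>T. open T \<and> f z \<in> T \<and> T \<subseteq> f ` V"
        by (intro exI[of _ "f ` ball z r"]) auto
    qed
    \<comment> \<open>Any sheet over \<open>T\<close> maps onto \<open>T\<close>, which contains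
      \<open>x\<close>. So a point outside the image has no sheets above its neighbourhood
      \<open>T\<close>, and all of \<open>T\<close> lies outside the image.\<close>
    moreover have "open (P - f ` V)"
    proof (subst open_subopen, safe)
      fix x assume x: "x \<in> P" "x \<notin> f ` V"
      obtain T v where T: "x \<in> T" "open T" "T \<subseteq> P" "\<Union>v = V \<inter> f -` T"
        "\<forall>u\<in>v. \<exists>q. homeomorphism u T f q"
        using even[OF x(1)] by metis
      have "v = {}"
      proof (rule ccontr)
        assume "v \<noteq> {}"
        then obtain u q where "u \<in> v" "homeomorphism u T f q" using T(5) by blast
        then have "f ` u = T" "u \<subseteq> V" using T(4) by (auto simp: homeomorphism_def)
        with x T(1) show False by blast
      qed
      then have "T \<inter> f ` V = {}" using T(4) by auto
      then show "\<exists>T. open T \<and> x \<in> T \<and> T \<subseteq> P - f ` V" using T by blast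
    qed
    ultimately have "P - f ` V = {} \<or> f ` V = {}"
      using connectedD[OF P(2), of "f ` V" "P - f ` V"] fim by blast
    then show ?thesis using V(2) fim by auto
  qed
  show ?thesis
  proof
    show "continuous_on V f" "f ` V = P" by fact+
    fix x assume x: "x \<in> P"
    obtain T v where T: "x \<in> T" "open T" "T \<subseteq> P" "\<Union>v = V \<inter> f -` T"
        "\<forall>u\<in>v. open u" "pairwise disjnt v" "\<forall>u\<in>v. \<exists>q. homeomorphism u T f q"
      using even[OF x] by metis
    have "\<forall>u\<in>v. openin (top_of_set V) u"
      using T(4,5) by (metis Int_lower1 Sup_upper open_subset order_trans)
    moreover have "openin (top_of_set P) T" using T by (simp add: open_subset)
    ultimately show "\<exists>T. x \<in> T \<and> openin (top_of_set P) T \<and>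
        (\<exists>v. \<Union>v = V \<inter> f -` T \<and> (\<forall>u\<in>v. openin (top_of_set V) u) \<and>
             pairwise disjnt v \<and> (\<forall>u\<in>v. \<exists>q. homeomorphism u T f q))"
      using T by blast
  qed
qed

text \<open>The only possible critical value is 0, so \<open>f\<close> covers the punctured disc and
  the radial contraction lifts to a homotopy that is extended by fixing the zeros of
  \<open>f\<close>. \<open>W\<close> might contain zeros other than \<zeta>, but the end of the
  homotopy has connected image with small values of \<open>f\<close>, and this confines the image to
  one disc about \<zeta>. Hence \<open>W\<close> is contractible.\<close>

lemma simply_connected_proper_holomorphic_preimage_ball:
  fixes f :: "complex \<Rightarrow> complex"
  assumes holf: "f holomorphic_on W" and W: "open W" "connected W"
    and fim: "f ` W \<subseteq> ball 0 r"
    and proper: "\<And>K. compact K \<Longrightarrow> K \<subseteq> ball 0 r \<Longrightarrow> compact (W \<inter> f -` K)"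
    and crit: "\<And>z. z \<in> W \<Longrightarrow> deriv f z = 0 \<Longrightarrow> f z = 0"
    and \<zeta>: "\<zeta> \<in> W" "f \<zeta> = 0"
  shows "simply_connected W"
proof -
  have contf: "continuous_on W f"
    using holf by (rule holomorphic_on_imp_continuous_on)
  have r: "r > 0" using \<zeta> fim by force
  define V where "V = W \<inter> f -` (- {0})"
  have V: "open V" "V \<subseteq> W"
    unfolding V_def using continuous_open_preimage[OF contf W(1), of "- {0}"] by auto
  \<comment> \<open>If \<open>f\<close> vanished identically, \<open>W\<close> would be compact as
    the preimage of {0}, which is impossible for a nonempty open set.\<close>
  have "V \<noteq> {}"
  proof
    assume "V = {}"
    then have "W = W \<inter> f -` {0}" by (auto simp: V_def)
    then have "compact W" using proper[of "{0}"] r by auto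
    then show False using W(1) \<zeta>(1) compact_open by blast
  qed
  have nonconst: "\<exists>w\<in>W. f w \<noteq> 0" using \<open>V \<noteq> {}\<close> by (auto simp: V_def)
  have cov: "covering_space V f (ball 0 r - {0})"
  proof (rule covering_space_proper_locally_biholomorphic)
    show "f holomorphic_on V" using holf V(2) holomorphic_on_subset by blast
    show "connected (ball 0 r - {0::complex})"
      by (rule connected_open_delete) auto
    show "f ` V \<subseteq> ball 0 r - {0}" using fim by (auto simp: V_def)
    show "compact (V \<inter> f -` K)" if "compact K" "K \<subseteq> ball 0 r - {0}" for K
    proof -
      have "V \<inter> f -` K = W \<inter> f -` K" using that by (auto simp: V_def)
      then show ?thesis using proper[of K] that by auto
    qed
  qed (use V \<open>V \<noteq> {}\<close> crit in \<open>auto simp: V_def\<close>)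
  \<comment> \<open>Take a circle around the zero on which \<open>f\<close> does not vanish and let
    \<open>m\<close> be a lower bound of its modulus there: a connected set that meets the disc and
    has smaller values cannot cross the circle. This is used twice, for continuity of the lifted
    homotopy at the zeros and for locating its end.\<close>
  have trap: "\<exists>s m. 0 < s \<and> s < \<sigma> \<and> 0 < m \<and> ball z0 s \<subseteq> W \<and>
      (\<forall>S. connected S \<longrightarrow> S \<subseteq> W \<longrightarrow> S \<inter> ball z0 s \<noteq> {} \<longrightarrow> (\<forall>z\<in>S. norm (f z) < m) \<longrightarrow> S \<subseteq> ball z0 s)"
    if z0: "z0 \<in> W" "f z0 = 0" and "\<sigma> > 0" for z0 \<sigma>
  proof -
    obtain w where w: "w \<in> W" "f w \<noteq> 0" using nonconst by blast
    obtain e where e: "0 < e" "ball z0 e \<subseteq> W" "\<And>z. z \<in> ball z0 e - {z0} \<Longrightarrow> f z \<noteq> 0"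
      using isolated_zeros[OF holf W(1,2) z0 w] by metis
    define s where "s = min e \<sigma> / 2"
    have s: "0 < s" "s < e" "s < \<sigma>" using e(1) \<open>\<sigma> > 0\<close> by (auto simp: s_def)
    have sub: "cball z0 s \<subseteq> ball z0 e" using s by auto
    have sph: "sphere z0 s \<subseteq> ball z0 e - {z0}" using s by auto
    have "compact (f ` sphere z0 s)"
      using sph e(2) by (intro compact_continuous_image continuous_on_subset[OF contf]) auto
    moreover have "0 \<notin> f ` sphere z0 s" using sph e(3) by force
    ultimately obtain m where m: "m > 0" "\<And>z. z \<in> sphere z0 s \<Longrightarrow> m \<le> norm (f z)"
      using separate_point_closed[of "f ` sphere z0 s" 0] compact_imp_closed
      by (metis dist_0_norm image_eqI)
    have "S \<subseteq> ball z0 s"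
      if S: "connected S" "S \<subseteq> W" "S \<inter> ball z0 s \<noteq> {}" "\<forall>z\<in>S. norm (f z) < m" for S
    proof (rule ccontr)
      assume "\<not> S \<subseteq> ball z0 s"
      then have "S \<inter> frontier (ball z0 s) \<noteq> {}"
        using connected_Int_frontier[OF S(1,3)] by blast
      then show False using m(2) S(4) s(1) by (force simp: not_less[symmetric])
    qed
    then show ?thesis using s m(1) sub e(2) ball_subset_cball[of z0 s] by (intro exI[of _ s] exI[of _ m]) auto
  qed
  obtain s m where sm: "0 < s" "0 < m" "ball \<zeta> s \<subseteq> W"
      "\<And>S. connected S \<Longrightarrow> S \<subseteq> W \<Longrightarrow> S \<inter> ball \<zeta> s \<noteq> {} \<Longrightarrow> (\<forall>z\<in>S. norm (f z) < m) \<Longrightarrow> S \<subseteq> ball \<zeta> s"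
    using trap[OF \<zeta>, of 1] by (metis zero_less_one)
  \<comment> \<open>The final contraction factor: \<open>m / r\<close> pushes the values of
    \<open>f\<close> below the threshold \<open>m\<close>, and 1/2 keeps the factor below 1.\<close>
  define \<epsilon> where "\<epsilon> = min (m / r) (1/2)"
  have \<epsilon>: "0 < \<epsilon>" "\<epsilon> < 1" "\<epsilon> * r \<le> m"
    using sm(2) r by (auto simp: \<epsilon>_def min_def field_simps)
  \<comment> \<open>Runs from 1 to \<epsilon> without reaching 0, so nonzero values stay in the
    punctured disc, where lifting is possible.\<close>
  define c where "c t = 1 - t * (1 - \<epsilon>)" for t :: real
  have c: "0 < c t" "c t \<le> 1" if "t \<in> {0..1}" for t
  proof -
    have "t * (1 - \<epsilon>) \<le> 1 * (1 - \<epsilon>)" using that \<epsilon> by (intro mult_right_mono) auto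
    then show "0 < c t" using \<epsilon>(1) by (simp add: c_def)
    show "c t \<le> 1" using that \<epsilon> by (simp add: c_def)
  qed
  have cf: "c t *\<^sub>R f z \<in> ball 0 r - {0}" if "t \<in> {0..1}" "z \<in> V" for t z
  proof -
    have "norm (f z) < r" "f z \<noteq> 0" using that(2) fim by (auto simp: V_def)
    moreover have "c t * norm (f z) \<le> 1 * norm (f z)"
      using c[OF that(1)] by (intro mult_right_mono) auto
    ultimately have "c t * norm (f z) < r" by linarith
    with \<open>f z \<noteq> 0\<close> show ?thesis using c[OF that(1)] by auto
  qed
  define h where "h = (\<lambda>(t, z). c t *\<^sub>R f z)"
  have conth: "continuous_on ({0..1} \<times> V) h"
    unfolding h_def c_def case_prod_beta
    by (intro continuous_intros continuous_on_compose2[OF continuous_on_subset[OF contf V(2)]]) auto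
  obtain k where k: "continuous_on ({0..1} \<times> V) k" "k \<in> ({0..1} \<times> V) \<rightarrow> V"
      "\<And>z. z \<in> V \<Longrightarrow> k (0, z) = z" "\<And>p. p \<in> {0..1} \<times> V \<Longrightarrow> h p = f (k p)"
  proof (rule covering_space_lift_homotopy[OF cov conth, of id])
    show "h \<in> {0..1} \<times> V \<rightarrow> ball 0 r - {0}" using cf by (auto simp: h_def)
    show "h (0, y) = f (id y)" for y by (simp add: h_def c_def)
  qed (auto intro: continuous_on_id)
  \<comment> \<open>The lift exists only over the punctured disc; at the zeros of \<open>f\<close>
    the homotopy is made stationary.\<close>
  define H where "H = (\<lambda>p. if f (snd p) = 0 then snd p else k p)"
  have HV: "H (t, z) = k (t, z)" if "z \<in> V" for t z using that by (simp add: H_def V_def)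
  have H0: "H (t, z) = z" if "f z = 0" for t z using that by (simp add: H_def)
  have Him: "H (t, z) \<in> W" if "t \<in> {0..1}" "z \<in> W" for t z
    using that k(2) V(2) by (auto simp: H_def V_def)
  have fH: "f (H (t, z)) = c t *\<^sub>R f z" if "t \<in> {0..1}" "z \<in> W" for t z
    using that k(4)[of "(t,z)"] by (auto simp: H_def V_def h_def)
  have nfH: "norm (f (H (t, z))) \<le> norm (f z)" if "t \<in> {0..1}" "z \<in> W" for t z
  proof -
    have "c t * norm (f z) \<le> 1 * norm (f z)"
      using c[OF that(1)] by (intro mult_right_mono) auto
    then show ?thesis using fH[OF that] c[OF that(1)] by simp
  qed
  have Hstart: "H (0, z) = z" if "z \<in> W" for z
    using that k(3) by (auto simp: H_def V_def)
  have contH: "continuous_on ({0..1} \<times> W) H"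
  proof (unfold continuous_on_eq_continuous_within, safe)
    fix t0 :: real and z0 assume t0: "t0 \<in> {0..1}" and z0: "z0 \<in> W"
    show "continuous (at (t0, z0) within {0..1} \<times> W) H"
    proof (cases "f z0 = 0")
      case False
      then have "z0 \<in> V" using z0 by (simp add: V_def)
      have "continuous_on ({0..1} \<times> V) H"
        using k(1) by (rule continuous_on_eq) (auto simp: HV)
      then have "continuous (at (t0, z0) within {0..1} \<times> V) H"
        using t0 \<open>z0 \<in> V\<close> by (simp add: continuous_on_eq_continuous_within)
      moreover have "at (t0, z0) within {0..1} \<times> V = at (t0, z0) within {0..1} \<times> W"
        using V \<open>z0 \<in> V\<close> by (intro at_within_nhd[of _ "UNIV \<times> V"] open_Times) auto
      ultimately show ?thesis by (simp add: continuous_within)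
    next
      case True
      show ?thesis
      proof (unfold continuous_within_eps_delta, intro allI impI)
        fix e :: real assume "e > 0"
        obtain s m where sm: "0 < s" "s < e" "0 < m" "ball z0 s \<subseteq> W"
           "\<And>S. connected S \<Longrightarrow> S \<subseteq> W \<Longrightarrow> S \<inter> ball z0 s \<noteq> {} \<Longrightarrow> (\<forall>z\<in>S. norm (f z) < m) \<Longrightarrow> S \<subseteq> ball z0 s"
          using trap[OF z0 True \<open>e > 0\<close>] by metis
        obtain d where d: "d > 0" "\<And>z. z \<in> W \<Longrightarrow> dist z z0 < d \<Longrightarrow> norm (f z) < m"
          using contf z0 sm(3) True unfolding continuous_on_iff by (metis dist_0_norm dist_commute)
        show "\<exists>d>0. \<forall>p\<in>{0..1} \<times> W. dist p (t0, z0) < d \<longrightarrow> dist (H p) (H (t0, z0)) < e"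
        proof (intro exI[of _ "min d s"] conjI ballI impI)
          fix p assume p: "p \<in> {0..1} \<times> W" "dist p (t0, z0) < min d s"
          obtain t z where tz: "p = (t, z)" by (cases p)
          have "dist z z0 < min d s"
            using p(2) dist_snd_le[of p "(t0, z0)"] tz by simp
          then have z: "dist z z0 < d" "dist z z0 < s" by auto
          have tW: "t \<in> {0..1}" "z \<in> W" using p(1) tz by auto
          have "H (t, z) \<in> ball z0 s"
          proof (cases "f z = 0")
            case True
            then show ?thesis using z H0 by (simp add: dist_commute)
          next
            case False
            then have zV: "z \<in> V" using tW by (simp add: V_def)
            \<comment> \<open>The track of \<open>z\<close> is connected, starts at \<open>z\<close>
              near \<open>z0\<close>, and along it the modulus of \<open>f\<close> never exceeds its
              initial value. The trap therefore keeps the whole track near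
              \<open>z0\<close>.\<close>
            define S where "S = (\<lambda>u. H (u, z)) ` {0..1}"
            have "continuous_on {0..1} (\<lambda>u. k (u, z))"
              using zV by (intro continuous_on_compose2[OF k(1)] continuous_intros) auto
            then have "connected S"
              unfolding S_def using HV[OF zV] by (intro connected_continuous_image) auto
            moreover have "S \<subseteq> W" using Him tW(2) by (auto simp: S_def)
            moreover have "H (0, z) \<in> S" unfolding S_def by force
            then have "S \<inter> ball z0 s \<noteq> {}"
              using Hstart[OF tW(2)] z by (auto simp: dist_commute)
            moreover have "\<forall>y\<in>S. norm (f y) < m"
              using nfH tW(2) d(2)[OF tW(2) z(1)] by (force simp: S_def)
            ultimately have "S \<subseteq> ball z0 s" by (rule sm(5))
            then show ?thesis using tW(1) unfolding S_def by blast
          qed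
          then show "dist (H p) (H (t0, z0)) < e"
            using sm(2) H0[OF True] tz by (simp add: dist_commute)
        qed (use d sm in auto)
      qed
    qed
  qed
  define R where "R z = H (1, z)" for z
  have contR: "continuous_on W R"
    unfolding R_def by (intro continuous_on_compose2[OF contH] continuous_intros) auto
  \<comment> \<open>The trap again, now for the whole image of the end map, which meets the disc
    because \<zeta> is fixed.\<close>
  have "R ` W \<subseteq> ball \<zeta> s"
  proof (rule sm(4))
    show "connected (R ` W)" using contR W(2) by (rule connected_continuous_image)
    show "R ` W \<subseteq> W" using Him by (auto simp: R_def)
    have "R \<zeta> = \<zeta>" using H0 \<zeta>(2) by (simp add: R_def)
    then show "R ` W \<inter> ball \<zeta> s \<noteq> {}" using \<zeta>(1) sm(1) by force
    show "\<forall>y\<in>R ` W. norm (f y) < m"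
    proof safe
      fix z assume z: "z \<in> W"
      have "norm (f (R z)) = \<epsilon> * norm (f z)"
        using fH[of 1 z] z \<epsilon>(1) by (simp add: R_def c_def)
      also have "\<dots> < \<epsilon> * r" using z fim \<epsilon>(1) by auto
      finally show "norm (f (R z)) < m" using \<epsilon>(3) by simp
    qed
  qed
  then obtain a where "homotopic_with_canon (\<lambda>h. True) W (ball \<zeta> s) R (\<lambda>x. a)"
    using nullhomotopic_into_contractible[OF contR, of "ball \<zeta> s"] convex_imp_contractible[of "ball \<zeta> s"]
    by (metis convex_ball image_subset_iff_funcset)
  then have "homotopic_with_canon (\<lambda>h. True) W W R (\<lambda>x. a)"
    using sm(3) by (rule homotopic_with_subset_right)
  moreover have "homotopic_with_canon (\<lambda>h. True) W W id R"
    by (subst homotopic_with)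
       (use contH Him Hstart in \<open>auto simp: R_def intro!: exI[of _ H]\<close>)
  ultimately have "contractible W"
    unfolding contractible_def using homotopic_with_trans by blast
  then show ?thesis by (rule contractible_imp_simply_connected)
qed

section \<open>Basins of attraction\<close>

text \<open>Serves to split an arbitrary sequence of iterates into the two cases that matter for
  normality: either one exponent recurs infinitely often, or the exponents tend to infinity.\<close>

lemma nat_seq_subseq_constant_or_at_top:
  fixes n :: "nat \<Rightarrow> nat"
  shows "\<exists>r. strict_mono r \<and> ((\<exists>c. \<forall>k. n (r k) = c) \<or> filterlim (\<lambda>k. n (r k)) at_top sequentially)"
proof (cases "\<exists>c. infinite {k. n k = c}")
  case True
  then obtain c where c: "infinite {k. n k = c}" by blast
  have "n (enumerate {k. n k = c} k) = c" for k
    using enumerate_in_set[OF c, of k] by simp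
  then show ?thesis
    using strict_mono_enumerate[OF c] by blast
next
  case False
  have "\<forall>\<^sub>F k in sequentially. M \<le> n k" for M
  proof -
    have "{k. n k < M} = (\<Union>c<M. {k. n k = c})" by auto
    then have "finite {k. n k < M}" using False by simp
    then have "\<forall>\<^sub>F k in cofinite. M \<le> n k"
      by (simp add: eventually_cofinite not_le)
    then show ?thesis by (simp add: cofinite_eq_sequentially)
  qed
  then have "filterlim n at_top sequentially"
    by (simp add: filterlim_at_top)
  then show ?thesis
    using strict_mono_id by (intro exI[of _ id]) simp
qed

definition basin :: "('a::topological_space \<Rightarrow> 'a) \<Rightarrow> 'a \<Rightarrow> 'a set" where
  "basin f x0 = {x. (\<lambda>n. (f ^^ n) x) \<longlonglongrightarrow> x0}"

lemma basin_disjoint: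
  fixes x y :: "'a::t2_space"
  shows "x \<noteq> y \<Longrightarrow> basin f x \<inter> basin f y = {}"
  unfolding basin_def using LIMSEQ_unique by blast

lemma funpow_fixpoint: "f x = x \<Longrightarrow> (f ^^ n) x = x"
  by (induction n) auto

lemma fixpoint_in_basin_iff:
  fixes x y :: "'a::t2_space"
  shows "f x = x \<Longrightarrow> x \<in> basin f y \<longleftrightarrow> x = y"
  by (simp add: basin_def funpow_fixpoint LIMSEQ_const_iff)

lemma basin_step_iff: "f x \<in> basin f x0 \<longleftrightarrow> x \<in> basin f x0"
proof -
  have "(\<lambda>n. (f ^^ n) (f x)) = (\<lambda>n. (f ^^ Suc n) x)"
    by (simp add: funpow_swap1)
  then show ?thesis
    unfolding basin_def using filterlim_sequentially_Suc[of "\<lambda>n. (f ^^ n) x"] by simp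
qed

lemma basin_funpow_iff: "(f ^^ n) x \<in> basin f x0 \<longleftrightarrow> x \<in> basin f x0"
  by (induction n) (auto simp: basin_step_iff)

lemma continuous_on_funpow:
  fixes f :: "'a::topological_space \<Rightarrow> 'a"
  assumes "continuous_on UNIV f"
  shows "continuous_on UNIV (f ^^ n)"
proof (induction n)
  case (Suc n)
  moreover have "continuous_on (range (f ^^ n)) f"
    using assms continuous_on_subset by blast
  ultimately show ?case
    using continuous_on_compose by force
qed (simp add: continuous_on_id')

text \<open>Provides the compact sets on which normality is tested at boundary points of a
  basin.\<close>

lemma compact_insert_limit:
  fixes y :: "nat \<Rightarrow> 'a::topological_space"
  assumes "y \<longlonglongrightarrow> x"
  shows "compact (insert x (range y))"
proof (rule compactI)
  fix \<C> assume \<C>: "\<forall>G\<in>\<C>. open G" "insert x (range y) \<subseteq> \<Union>\<C>"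
  then obtain G where G: "G \<in> \<C>" "x \<in> G" "open G" by auto
  then obtain N where N: "\<And>n. n \<ge> N \<Longrightarrow> y n \<in> G"
    using topological_tendstoD[OF assms] unfolding eventually_sequentially by metis
  have "\<forall>n. \<exists>S\<in>\<C>. y n \<in> S" using \<C>(2) by auto
  then obtain S where S: "\<And>n. S n \<in> \<C>" "\<And>n. y n \<in> S n" by metis
  have "insert x (range y) \<subseteq> \<Union>(insert G (S ` {..<N}))"
  proof
    fix z assume "z \<in> insert x (range y)"
    then consider "z = x" | n where "z = y n" "n < N" | n where "z = y n" "n \<ge> N"
      using not_le by blast
    then show "z \<in> \<Union>(insert G (S ` {..<N}))"
      by cases (use G N S in auto)
  qed
  then show "\<exists>\<C>'\<subseteq>\<C>. finite \<C>' \<and> insert x (range y) \<subseteq> \<Union>\<C>'"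
    using G(1) S(1) by (intro exI[of _ "insert G (S ` {..<N})"]) auto
qed

text \<open>Attraction in the form that the comparison of basin and Fatou set uses: uniform
  convergence of the iterates on a whole neighbourhood.\<close>

locale attracting_neighbourhood =
  fixes f :: "'a::metric_space \<Rightarrow> 'a" and x0 :: 'a and B :: "'a set"
  assumes contf: "continuous_on UNIV f"
    and openB: "open B" and x0B: "x0 \<in> B"
    and unif: "uniform_limit B (\<lambda>n. f ^^ n) (\<lambda>_. x0) sequentially"
begin

lemma basin_iff: "x \<in> basin f x0 \<longleftrightarrow> (\<exists>n. (f ^^ n) x \<in> B)"
proof
  assume "x \<in> basin f x0"
  then have "\<forall>\<^sub>F n in sequentially. (f ^^ n) x \<in> B"
    unfolding basin_def using openB x0B topological_tendstoD by blast
  then show "\<exists>n. (f ^^ n) x \<in> B"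
    by (auto dest: eventually_happens)
next
  assume "\<exists>n. (f ^^ n) x \<in> B"
  then obtain m where "(f ^^ m) x \<in> B" by blast
  then have "(\<lambda>n. (f ^^ n) ((f ^^ m) x)) \<longlonglongrightarrow> x0"
    using tendsto_uniform_limitI[OF unif] by blast
  then have "(\<lambda>n. (f ^^ (n + m)) x) \<longlonglongrightarrow> x0"
    by (simp add: funpow_add)
  then show "x \<in> basin f x0"
    unfolding basin_def using LIMSEQ_offset by fastforce
qed

text \<open>Some iterate carries a neighbourhood of the point into \<open>B\<close>, from where
  convergence to \<open>x0\<close> is uniform. Sequences of iterates with divergent exponents thus
  converge uniformly, and otherwise a constant subsequence exists.\<close>

lemma basin_subset_fatou_set: "basin f x0 \<subseteq> fatou_set f"
proof
  fix x assume "x \<in> basin f x0"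
  then obtain m where m: "(f ^^ m) x \<in> B" using basin_iff by blast
  define U where "U = (f ^^ m) -` B"
  have "open U"
    unfolding U_def using open_vimage[OF openB continuous_on_funpow[OF contf]] .
  moreover have "x \<in> U" using m by (simp add: U_def)
  moreover have "normal_family_on {f ^^ n |n. n > 0} U"
    unfolding normal_family_on_def
  proof (intro allI impI)
    fix s :: "nat \<Rightarrow> 'a \<Rightarrow> 'a" assume "range s \<subseteq> {f ^^ n |n. n > 0}"
    then have "\<forall>k. \<exists>n. s k = f ^^ n" by blast
    then obtain n where n: "\<And>k. s k = f ^^ n k" by metis
    obtain r where r: "strict_mono r"
      "(\<exists>c. \<forall>k. n (r k) = c) \<or> filterlim (\<lambda>k. n (r k)) at_top sequentially"
      using nat_seq_subseq_constant_or_at_top by blast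
    have "\<exists>g. uniform_limit U (s \<circ> r) g sequentially"
      using r(2)
    proof
      assume "\<exists>c. \<forall>k. n (r k) = c"
      then obtain c where "\<And>k. n (r k) = c" by blast
      then have "s \<circ> r = (\<lambda>_. f ^^ c)" using n by auto
      then show ?thesis by (auto intro: uniform_limit_const)
    next
      assume top: "filterlim (\<lambda>k. n (r k)) at_top sequentially"
      have "uniform_limit U (s \<circ> r) (\<lambda>_. x0) sequentially"
      proof (rule uniform_limitI)
        fix e :: real assume "e > 0"
        then obtain N where N: "\<And>j y. j \<ge> N \<Longrightarrow> y \<in> B \<Longrightarrow> dist ((f ^^ j) y) x0 < e"
          using unif unfolding uniform_limit_iff eventually_sequentially by metis
        have "dist ((f ^^ j) y) x0 < e" if "j \<ge> N + m" "y \<in> U" for j y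
        proof -
          have "(f ^^ j) y = (f ^^ (j - m)) ((f ^^ m) y)"
            using that(1) by (metis add_leD2 comp_apply funpow_add le_add_diff_inverse2)
          then show ?thesis using N[of "j - m"] that by (simp add: U_def)
        qed
        moreover have "\<forall>\<^sub>F k in sequentially. n (r k) \<ge> N + m"
          using top by (simp add: filterlim_at_top)
        ultimately show "\<forall>\<^sub>F k in sequentially. \<forall>y\<in>U. dist ((s \<circ> r) k y) x0 < e"
          by (auto elim!: eventually_mono simp: n)
      qed
      then show ?thesis by blast
    qed
    then show "\<exists>r g. strict_mono r \<and> (\<forall>K. compact K \<and> K \<subseteq> U \<longrightarrow> uniform_limit K (s \<circ> r) g sequentially)"
      using r(1) uniform_limit_on_subset by metis
  qed
  ultimately show "x \<in> fatou_set f"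
    unfolding fatou_set_def by blast
qed

text \<open>A limit of iterates is continuous along a sequence in the basin together with its limit, so it
  takes the value \<open>x0\<close> at the limit point too: no identity theorem is needed.\<close>

lemma fatou_set_Int_closure_basin: "fatou_set f \<inter> closure (basin f x0) \<subseteq> basin f x0"
proof safe
  fix x assume "x \<in> fatou_set f" and cl: "x \<in> closure (basin f x0)"
  then obtain U where U: "open U" "x \<in> U" "normal_family_on {f ^^ n |n. n > 0} U"
    unfolding fatou_set_def by blast
  \<comment> \<open>The exponent is shifted because the family contains only positive
    iterates.\<close>
  have "range (\<lambda>n. f ^^ Suc n) \<subseteq> {f ^^ n |n. n > 0}" by blast
  then have "\<exists>r g. strict_mono r \<and>
      (\<forall>K. compact K \<and> K \<subseteq> U \<longrightarrow> uniform_limit K ((\<lambda>n. f ^^ Suc n) \<circ> r) g sequentially)"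
    using U(3) unfolding normal_family_on_def by (elim allE impE)
  then obtain r g where r: "strict_mono r" and
    g: "\<And>K. compact K \<Longrightarrow> K \<subseteq> U \<Longrightarrow> uniform_limit K ((\<lambda>n. f ^^ Suc n) \<circ> r) g sequentially"
    by metis
  have "x \<in> closure (basin f x0 \<inter> U)"
    using cl U(1,2) open_Int_closure_subset[of U "basin f x0"] by (auto simp: Int_commute)
  then obtain y where y: "\<And>n. y n \<in> basin f x0 \<inter> U" "y \<longlonglongrightarrow> x"
    unfolding closure_sequential by blast
  define K where "K = insert x (range y)"
  have "compact K"
    unfolding K_def using y(2) by (rule compact_insert_limit)
  have "K \<subseteq> U" using y(1) U(2) by (auto simp: K_def)
  have ul: "uniform_limit K ((\<lambda>n. f ^^ Suc n) \<circ> r) g sequentially"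
    using g \<open>compact K\<close> \<open>K \<subseteq> U\<close> by blast
  have "continuous_on K (((\<lambda>n. f ^^ Suc n) \<circ> r) n)" for n
    using continuous_on_subset[OF continuous_on_funpow[OF contf, of "Suc (r n)"]] by (simp add: comp_def)
  then have contg: "continuous_on K g"
    by (intro uniform_limit_theorem[OF _ ul]) auto
  have lim: "(\<lambda>n. (f ^^ Suc (r n)) z) \<longlonglongrightarrow> g z" if "z \<in> K" for z
    using tendsto_uniform_limitI[OF ul that] by (simp add: comp_def)
  have "g (y n) = x0" for n
  proof -
    have "(\<lambda>n. (f ^^ n) z) \<longlonglongrightarrow> x0" if "z = y n" for z
      using y(1)[of n] that by (simp add: basin_def)
    then have "(\<lambda>k. (f ^^ Suc (r k)) (y n)) \<longlonglongrightarrow> x0"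
      using LIMSEQ_subseq_LIMSEQ[of "\<lambda>k. (f ^^ k) (y n)" x0 "\<lambda>k. Suc (r k)"] r
      by (auto simp: comp_def strict_mono_def)
    moreover have "y n \<in> K" by (simp add: K_def)
    ultimately show ?thesis using lim LIMSEQ_unique by blast
  qed
  moreover have "(\<lambda>n. g (y n)) \<longlonglongrightarrow> g x"
    using contg y(2) unfolding K_def
    by (rule continuous_on_tendsto_compose) auto
  ultimately have "g x = x0"
    by (simp add: LIMSEQ_const_iff)
  then have "(\<lambda>n. (f ^^ Suc (r n)) x) \<longlonglongrightarrow> x0"
    using lim[of x] by (simp add: K_def)
  then have "\<forall>\<^sub>F n in sequentially. (f ^^ Suc (r n)) x \<in> B"
    using openB x0B topological_tendstoD by blast
  then have "\<exists>n. (f ^^ Suc (r n)) x \<in> B"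
    using eventually_happens'[OF sequentially_bot] by blast
  then show "x \<in> basin f x0"
    using basin_iff by blast
qed

text \<open>The basin is relatively closed in the Fatou set, hence so is its component
  \<open>A\<close> in the Fatou component \<open>Y\<close>: adding a limit point in \<open>Y\<close>
  keeps \<open>A\<close> connected and inside the basin. As \<open>A\<close> is also open and
  \<open>Y\<close> is connected, they coincide. Openness is assumed since a metric space need not be
  locally connected.\<close>

lemma immediate_basin_eq:
  assumes op: "open (connected_component_set (basin f x0) x0)"
  shows "immediate_basin f x0 = connected_component_set (basin f x0) x0"
proof -
  define A where "A = connected_component_set (basin f x0) x0"
  define Y where "Y = connected_component_set (fatou_set f) x0"
  have "x0 \<in> basin f x0" using basin_iff x0B by (metis funpow_0)
  then have x0A: "x0 \<in> A" by (simp add: A_def)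
  have "A \<subseteq> Y"
    unfolding A_def Y_def using basin_subset_fatou_set by (rule connected_component_mono)
  have clA: "Y \<inter> closure A \<subseteq> A"
  proof safe
    fix x assume x: "x \<in> Y" "x \<in> closure A"
    have "A \<subseteq> basin f x0" unfolding A_def by (rule connected_component_subset)
    then have "x \<in> basin f x0"
      using x fatou_set_Int_closure_basin closure_mono connected_component_subset
      unfolding Y_def by blast
    then have "insert x A \<subseteq> basin f x0" using \<open>A \<subseteq> basin f x0\<close> by simp
    moreover have "connected A" by (simp add: A_def)
    then have "connected (insert x A)"
      by (rule connected_intermediate_closure) (use x(2) closure_subset in auto)
    ultimately have "insert x A \<subseteq> A"
      using x0A unfolding A_def by (intro connected_component_maximal) auto
    then show "x \<in> A" by simp
  qed
  have "Y \<subseteq> A"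
  proof (rule ccontr)
    assume "\<not> Y \<subseteq> A"
    then have "Y \<inter> - closure A \<noteq> {}" using clA by blast
    moreover have "Y \<inter> A \<noteq> {}" using x0A \<open>A \<subseteq> Y\<close> by blast
    moreover have "Y \<subseteq> A \<union> - closure A" using clA by blast
    moreover have "A \<inter> - closure A \<inter> Y = {}" using closure_subset by blast
    ultimately have "\<not> connected Y"
      using op unfolding connected_def A_def[symmetric] by (metis Int_commute closed_closure open_Compl)
    then show False by (simp add: Y_def)
  qed
  with \<open>A \<subseteq> Y\<close> show ?thesis
    unfolding immediate_basin_def A_def Y_def by blast
qed

end

section \<open>Topology of the Riemann sphere\<close>

lemma dist_stereo: "dist (stereo x) (stereo y) = dist x y"
  by (simp add: dist_riemann_sphere_def)

text \<open>\<open>stereo\<close> is an isometric embedding, so continuity into the sphere can be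
  checked on Euclidean coordinates.\<close>

lemma continuous_on_sphere_iff:
  "continuous_on S f \<longleftrightarrow> continuous_on S (\<lambda>x. stereo (f x))"
  unfolding continuous_on_def tendsto_iff dist_stereo by (rule refl)

lemma continuous_on_stereo: "continuous_on S stereo"
  by (simp flip: continuous_on_sphere_iff)

lemma one_plus_norm_pos: "1 + (cmod z)\<^sup>2 > 0" "1 + (cmod z)\<^sup>2 \<noteq> 0" "(cmod z)\<^sup>2 + 1 \<noteq> 0"
  using zero_le_power2[of "cmod z"] by linarith+

lemma continuous_on_Fin: "continuous_on S Fin"
  unfolding continuous_on_sphere_iff
  using one_plus_norm_pos by (auto intro!: continuous_intros)

text \<open>The affine chart. Its value at \<open>Infty\<close> is a default; the results on it keep
  away from that point.\<close>

fun the_Fin :: "riemann_sphere \<Rightarrow> complex" where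
  "the_Fin (Fin z) = z"
| "the_Fin Infty = 0"

text \<open>The chart is stereographic projection from the north pole, which makes its continuity
  visible.\<close>

lemma the_Fin_stereo: "x \<noteq> Infty \<Longrightarrow> the_Fin x = fst (stereo x) /\<^sub>R (1 - snd (stereo x))"
proof (cases x)
  case (Fin z)
  have "1 - snd (stereo x) = 2 / (1 + (cmod z)\<^sup>2)"
    using one_plus_norm_pos[of z] Fin by (simp add: field_simps)
  then show ?thesis using one_plus_norm_pos[of z] Fin by (simp add: field_simps)
qed simp

lemma snd_stereo_neq_1: "x \<noteq> Infty \<Longrightarrow> snd (stereo x) \<noteq> 1"
proof (cases x)
  case (Fin z)
  then show ?thesis using one_plus_norm_pos[of z] by (simp add: divide_eq_eq)
qed simp

lemma continuous_on_the_Fin: "Infty \<notin> S \<Longrightarrow> continuous_on S the_Fin"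
proof -
  assume S: "Infty \<notin> S"
  have "continuous_on S (\<lambda>x. fst (stereo x) /\<^sub>R (1 - snd (stereo x)))"
    by (intro continuous_intros continuous_on_stereo) (metis S eq_iff_diff_eq_0 snd_stereo_neq_1)
  then show ?thesis
    by (rule continuous_on_eq) (metis S the_Fin_stereo)
qed

lemma open_vimage_Fin: "open U \<Longrightarrow> open (Fin -` U)"
  by (intro open_vimage continuous_on_Fin)

lemma closed_vimage_Fin: "closed U \<Longrightarrow> closed (Fin -` U)"
  by (intro closed_vimage continuous_on_Fin)

lemma open_Fin_image:
  assumes "open U"
  shows "open (Fin ` U)"
proof -
  have "open (- {Infty} \<inter> the_Fin -` U)"
    by (intro continuous_open_preimage continuous_on_the_Fin open_Compl assms) auto
  moreover have "- {Infty} \<inter> the_Fin -` U = Fin ` U"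
  proof (intro set_eqI)
    fix x show "x \<in> - {Infty} \<inter> the_Fin -` U \<longleftrightarrow> x \<in> Fin ` U"
      by (cases x) auto
  qed
  ultimately show ?thesis by simp
qed

lemma dist_Fin_Infty: "(dist (Fin z) Infty)\<^sup>2 = 4 / (1 + (cmod z)\<^sup>2)"
proof -
  let ?t = "(cmod z)\<^sup>2"
  have pos: "1 + ?t > 0" by (rule one_plus_norm_pos)
  have "(dist (Fin z) Infty)\<^sup>2 = (2 / (1 + ?t))\<^sup>2 * ?t + ((?t - 1) / (?t + 1) - 1)\<^sup>2"
    unfolding dist_riemann_sphere_def dist_prod_def
    by (simp add: dist_norm power_mult_distrib power_divide)
  also have "(?t - 1) / (?t + 1) - 1 = - (2 / (1 + ?t))"
    using pos by (simp add: field_simps)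
  also have "(2 / (1 + ?t))\<^sup>2 * ?t + (- (2 / (1 + ?t)))\<^sup>2 = (2 / (1 + ?t))\<^sup>2 * (1 + ?t)"
    by (simp add: algebra_simps)
  also have "\<dots> = 4 / (1 + ?t)"
  proof -
    have "(2 / u)\<^sup>2 * u = 4 / u" if "u > 0" for u :: real
      using that by (simp add: power2_eq_square)
    then show ?thesis using pos by blast
  qed
  finally show ?thesis .
qed

text \<open>A closed set missing infinity keeps some chordal distance \<open>e\<close> from it,
  which bounds the modulus by \<open>2 / e\<close>.\<close>

lemma bounded_vimage_Fin:
  assumes "closed S" "Infty \<notin> S"
  shows "bounded (Fin -` S)"
proof -
  have "open (- S)" "Infty \<in> - S" using assms by auto
  then obtain e where e: "e > 0" "\<And>x. dist x Infty < e \<Longrightarrow> x \<in> - S"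
    unfolding open_dist by metis
  have "cmod z \<le> 2 / e" if "z \<in> Fin -` S" for z
  proof -
    have "e \<le> dist (Fin z) Infty" using e(2) that by force
    then have "e\<^sup>2 \<le> 4 / (1 + (cmod z)\<^sup>2)"
      using e(1) by (metis dist_Fin_Infty less_imp_le power_mono)
    then have "e\<^sup>2 * (1 + (cmod z)\<^sup>2) \<le> 4"
      using one_plus_norm_pos[of z] by (simp add: field_simps)
    then have "e\<^sup>2 * (cmod z)\<^sup>2 \<le> 4"
      using zero_le_power2[of e] unfolding distrib_left by linarith
    then have "(e * cmod z)\<^sup>2 \<le> 2\<^sup>2"
      by (simp add: power_mult_distrib)
    then have "e * cmod z \<le> 2"
      by (rule power2_le_imp_le) simp
    then show ?thesis using e(1) by (simp add: field_simps)
  qed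
  then show ?thesis by (auto simp: bounded_iff)
qed

text \<open>\<open>Fin\<close> and \<open>the_Fin\<close> are mutually inverse and continuous off
  infinity, so connected sets can be moved in both directions.\<close>

lemma connected_component_Fin:
  assumes S: "Infty \<notin> S"
  shows "connected_component_set S (Fin z) = Fin ` connected_component_set (Fin -` S) z"
proof (cases "Fin z \<in> S")
  case True
  let ?A = "connected_component_set (Fin -` S) z"
  show ?thesis
  proof (rule connected_component_unique)
    show "Fin z \<in> Fin ` ?A" using True by simp
    show "Fin ` ?A \<subseteq> S" using connected_component_subset by fast
    show "connected (Fin ` ?A)"
      by (intro connected_continuous_image continuous_on_Fin) simp
    fix c assume c: "Fin z \<in> c" "c \<subseteq> S" "connected c"
    have "connected (the_Fin ` c)"
      using S c by (intro connected_continuous_image continuous_on_the_Fin) auto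
    moreover have fin: "Fin (the_Fin x) = x" if "x \<in> c" for x
      using that S c(2) by (cases x) auto
    then have "the_Fin ` c \<subseteq> Fin -` S" using c(2) by auto
    moreover have "z \<in> the_Fin ` c" using c(1) by force
    ultimately have "the_Fin ` c \<subseteq> ?A" by (intro connected_component_maximal)
    then show "c \<subseteq> Fin ` ?A" using fin by force
  qed
next
  case False
  then have "connected_component_set S (Fin z) = {}" "connected_component_set (Fin -` S) z = {}"
    by (auto simp only: connected_component_eq_empty vimage_eq)
  then show ?thesis by (simp only: image_empty)
qed

lemma simply_connected_Fin_image:
  assumes "simply_connected A"
  shows "simply_connected (Fin ` A)"
  unfolding simply_connected_def
proof (intro allI impI, elim conjE)
  fix p q
  assume p: "path p" "pathfinish p = pathstart p" "path_image p \<subseteq> Fin ` A"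
    and q: "path q" "pathfinish q = pathstart q" "path_image q \<subseteq> Fin ` A"
  have *: "path (the_Fin \<circ> g) \<and> path_image (the_Fin \<circ> g) \<subseteq> A"
    if "path g" "path_image g \<subseteq> Fin ` A" for g
  proof
    have "Infty \<notin> path_image g" using that by auto
    then show "path (the_Fin \<circ> g)"
      using that by (intro path_continuous_image continuous_on_the_Fin)
    show "path_image (the_Fin \<circ> g) \<subseteq> A"
      using that(2) unfolding path_image_compose by force
  qed
  have "homotopic_loops A (the_Fin \<circ> p) (the_Fin \<circ> q)"
    using assms *[of p] *[of q] p q unfolding simply_connected_def
    by (simp add: pathfinish_compose pathstart_compose)
  then have hom: "homotopic_loops (Fin ` A) (Fin \<circ> (the_Fin \<circ> p)) (Fin \<circ> (the_Fin \<circ> q))"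
    by (rule homotopic_loops_continuous_image) (auto intro: continuous_on_Fin)
  have eq: "homotopic_loops (Fin ` A) g (Fin \<circ> (the_Fin \<circ> g))"
    if "path g" "pathfinish g = pathstart g" "path_image g \<subseteq> Fin ` A" for g
  proof (rule homotopic_loops_eq[OF that(1,3,2)])
    fix t :: real assume "t \<in> {0..1}"
    then have "g t \<in> Fin ` A" using that(3) by (auto simp: path_image_def)
    then show "g t = (Fin \<circ> (the_Fin \<circ> g)) t" by auto
  qed
  show "homotopic_loops (Fin ` A) p q"
    using eq[OF p] hom eq[OF q] homotopic_loops_sym homotopic_loops_trans by blast
qed

text \<open>Extension of a plane map by fixing infinity, meant for negation and complex
  conjugation.\<close>

fun sphere_map :: "(complex \<Rightarrow> complex) \<Rightarrow> riemann_sphere \<Rightarrow> riemann_sphere" where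
  "sphere_map m (Fin z) = Fin (m z)"
| "sphere_map m Infty = Infty"

text \<open>In the coordinates of \<open>stereo\<close> the map acts as \<open>m\<close> on the
  first component and trivially on the second. Linearity is over the reals, so that conjugation is
  included.\<close>

lemma continuous_on_sphere_map:
  assumes m: "linear m" "\<And>z. cmod (m z) = cmod z"
  shows "continuous_on S (sphere_map m)"
proof -
  have st: "stereo (sphere_map m x) = (m (fst (stereo x)), snd (stereo x))" for x
    by (cases x) (simp_all add: m linear_cmul linear_0)
  have "isCont m x" for x
    using m(1) linear_continuous_at linear_conv_bounded_linear by blast
  then have "continuous_on S (\<lambda>x. (m (fst (stereo x)), snd (stereo x)))"
    by (intro continuous_intros continuous_on_stereo
         continuous_on_compose2[OF continuous_at_imp_continuous_on[of UNIV m]]) auto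
  then show ?thesis by (subst continuous_on_sphere_iff) (simp add: st)
qed

text \<open>The embedding in homogeneous coordinates \<open>[N : D]\<close>. The right-hand side has
  no singularity at \<open>D = 0\<close>, so rational maps need no separate continuity argument at
  poles.\<close>

lemma stereo_fraction:
  assumes "D \<noteq> 0 \<or> N \<noteq> 0"
  shows "stereo (if D = 0 then Infty else Fin (N / D)) =
    ((2 / ((cmod N)\<^sup>2 + (cmod D)\<^sup>2)) *\<^sub>R (N * cnj D),
     ((cmod N)\<^sup>2 - (cmod D)\<^sup>2) / ((cmod N)\<^sup>2 + (cmod D)\<^sup>2))"
proof (cases "D = 0")
  case False
  let ?n = "(cmod N)\<^sup>2" and ?d = "(cmod D)\<^sup>2"
  have d: "?d > 0" using False by simp
  have n: "?n \<ge> 0" by simp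
  have nd: "?n + ?d > 0" using d n by linarith
  have sq: "(cmod (N / D))\<^sup>2 = ?n / ?d" by (simp add: norm_divide power_divide)
  have "N / D = (1 / ?d) *\<^sub>R (N * cnj D)"
    using False by (simp add: scaleR_conv_of_real complex_norm_square field_simps flip: of_real_power)
  then have "(2 / (1 + ?n / ?d)) *\<^sub>R (N / D) = (2 / (1 + ?n / ?d) * (1 / ?d)) *\<^sub>R (N * cnj D)"
    by simp
  also have "2 / (1 + ?n / ?d) * (1 / ?d) = 2 / (?n + ?d)"
    using d nd by (simp add: field_simps)
  finally have "(2 / (1 + ?n / ?d)) *\<^sub>R (N / D) = (2 / (?n + ?d)) *\<^sub>R (N * cnj D)" .
  moreover have "(?n / ?d - 1) / (?n / ?d + 1) = (?n - ?d) / (?n + ?d)"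
  proof -
    have "?n / ?d - 1 = (?n - ?d) / ?d" "?n / ?d + 1 = (?n + ?d) / ?d"
      using d by (simp_all add: field_simps)
    then show ?thesis using d by simp
  qed
  ultimately show ?thesis using False sq by simp
qed (use assms in simp)

section \<open>Increasing unions of open sets\<close>

lemma compact_subset_incseq_open:
  assumes "compact K" "K \<subseteq> (\<Union>n. G n)" "\<And>n. open (G n)" "incseq G"
  shows "\<exists>n. K \<subseteq> G n"
proof -
  obtain I where I: "I \<subseteq> UNIV" "finite I" "K \<subseteq> (\<Union>n\<in>I. G n)"
    using assms(3,2) by (rule compactE_image[OF assms(1), of UNIV G])
  then obtain N where "\<forall>i\<in>I. i \<le> N" using finite_nat_set_iff_bounded_le by blast
  then have "(\<Union>n\<in>I. G n) \<subseteq> G N" using assms(4) by (auto simp: incseq_def)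
  then show ?thesis using I(3) by blast
qed

text \<open>Two loops have compact image, hence lie in a single member of the sequence and are
  homotopic already there.\<close>

lemma simply_connected_incseq_Union:
  assumes "\<And>n. simply_connected (W n)" "\<And>n. open (W n)" "incseq W"
  shows "simply_connected (\<Union>n. W n)"
  unfolding simply_connected_def
proof (intro allI impI, elim conjE)
  fix p q
  assume p: "path p" "pathfinish p = pathstart p" "path_image p \<subseteq> (\<Union>n. W n)"
    and q: "path q" "pathfinish q = pathstart q" "path_image q \<subseteq> (\<Union>n. W n)"
  have "compact (path_image p \<union> path_image q)"
    using p(1) q(1) by (intro compact_Un compact_path_image)
  moreover have "path_image p \<union> path_image q \<subseteq> (\<Union>n. W n)"
    using p(3) q(3) by blast
  ultimately obtain n where n: "path_image p \<union> path_image q \<subseteq> W n"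
    using compact_subset_incseq_open assms(2,3) by blast
  then have "homotopic_loops (W n) p q"
    using assms(1)[of n] p q unfolding simply_connected_def by simp
  then show "homotopic_loops (\<Union>n. W n) p q"
    by (rule homotopic_loops_subset) blast
qed

section \<open>Attracting fixed points of rational maps\<close>

text \<open>Allows any numerator and denominator without common zero in place of the normalised pair
  of \<open>quot_of_fract\<close>. As infinity is fixed, basins of finite fixed points contain
  neither infinity nor poles, and their dynamics can be studied in the plane.\<close>

locale rational_sphere_map =
  fixes C :: "riemann_sphere \<Rightarrow> riemann_sphere" and N D :: "complex poly"
  assumes degree_less: "degree D < degree N"
    and no_common_root: "\<And>z. poly D z \<noteq> 0 \<or> poly N z \<noteq> 0"
    and C_Fin: "\<And>z. C (Fin z) = (if poly D z = 0 then Infty else Fin (poly N z / poly D z))"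
    and C_Infty: "C Infty = Infty"
begin

lemma continuous_on_C_Fin: "continuous_on S (\<lambda>z. C (Fin z))"
proof -
  have nz: "(cmod (poly N z))\<^sup>2 + (cmod (poly D z))\<^sup>2 \<noteq> 0" for z
    using no_common_root[of z] by (auto simp: add_nonneg_eq_0_iff)
  have "stereo (C (Fin z)) =
      ((2 / ((cmod (poly N z))\<^sup>2 + (cmod (poly D z))\<^sup>2)) *\<^sub>R (poly N z * cnj (poly D z)),
       ((cmod (poly N z))\<^sup>2 - (cmod (poly D z))\<^sup>2) / ((cmod (poly N z))\<^sup>2 + (cmod (poly D z))\<^sup>2))" for z
    unfolding C_Fin by (rule stereo_fraction) (rule no_common_root)
  then show ?thesis
    using nz by (subst continuous_on_sphere_iff) (auto intro!: continuous_intros)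
qed

lemma continuous_on_C: "continuous_on UNIV C"
proof (rule continuous_at_imp_continuous_on, rule ballI)
  fix x
  show "isCont C x"
  proof (cases x)
    case (Fin z)
    have "continuous_on (range Fin) (\<lambda>x. C (Fin (the_Fin x)))"
      by (rule continuous_on_compose2[OF continuous_on_C_Fin[of UNIV] continuous_on_the_Fin]) auto
    then have "continuous_on (range Fin) C"
      by (rule continuous_on_eq) auto
    then show ?thesis
      using Fin continuous_on_eq_continuous_at open_Fin_image[OF open_UNIV] by blast
  next
    case Infty
    show ?thesis
      unfolding isCont_def tendsto_iff Infty C_Infty
    proof (intro allI impI)
      fix e :: real assume e: "e > 0"
      have "((\<lambda>z. poly D z / poly N z) \<longlongrightarrow> 0) at_infinity"
        by (rule poly_divide_tendsto_0_at_infinity[OF degree_less])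
      \<comment> \<open>The bound \<open>e / 2\<close> on the reciprocal of the value
        \<open>w\<close> yields \<open>4 / (1 + (cmod w)\<^sup>2) < e\<^sup>2\<close>, that is,
        chordal distance to infinity below \<open>e\<close>.\<close>
      then have "\<forall>\<^sub>F z in at_infinity. cmod (poly D z / poly N z) < e / 2"
        using e order_tendstoD(2)[OF tendsto_norm_zero, of _ at_infinity "e / 2"] by simp
      moreover have "\<forall>\<^sub>F z in at_infinity. poly N z \<noteq> 0"
        using degree_less by (intro filterlim_at_infinity_imp_eventually_ne filterlim_poly_at_infinity) simp
      ultimately have "\<forall>\<^sub>F z in at_infinity. cmod (poly D z / poly N z) < e / 2 \<and> poly N z \<noteq> 0"
        by (rule eventually_conj)
      then obtain b where b: "\<And>z. b \<le> cmod z \<Longrightarrow> cmod (poly D z / poly N z) < e / 2 \<and> poly N z \<noteq> 0"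
        unfolding eventually_at_infinity by blast
      have "open (- (Fin ` cball 0 b))"
        by (intro open_Compl compact_imp_closed compact_continuous_image continuous_on_Fin) simp
      moreover have "dist (C y) Infty < e" if y: "y \<in> - (Fin ` cball 0 b)" "y \<noteq> Infty" for y
      proof -
        obtain z where z: "y = Fin z" "b \<le> cmod z"
          using y by (cases y) (auto simp: image_iff not_le intro: less_imp_le)
        show ?thesis
        proof (cases "poly D z = 0")
          case False
          let ?w = "poly N z / poly D z"
          have "(dist (C y) Infty)\<^sup>2 = 4 / (1 + (cmod ?w)\<^sup>2)"
            using False z(1) by (simp add: C_Fin dist_Fin_Infty)
          also have "\<dots> < e\<^sup>2"
          proof -
            have "cmod (poly D z / poly N z) = 1 / cmod ?w" by (simp add: norm_divide)
            then have "1 / cmod ?w < e / 2" using b[OF z(2)] by metis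
            then have "2 < e * cmod ?w" using b[OF z(2)] False by (simp add: field_simps)
            then have "2\<^sup>2 < (e * cmod ?w)\<^sup>2" by (intro power_strict_mono) auto
            then have "4 < e\<^sup>2 * (1 + (cmod ?w)\<^sup>2)"
              using e by (simp add: power_mult_distrib distrib_left add_pos_pos less_le_trans add.commute)
            then show ?thesis using one_plus_norm_pos[of ?w] by (simp add: divide_less_eq)
          qed
          finally show ?thesis using e by (simp add: power_less_imp_less_base)
        qed (use e z in \<open>simp add: C_Fin\<close>)
      qed
      ultimately show "\<forall>\<^sub>F y in at Infty. dist (C y) Infty < e"
        unfolding eventually_at_topological by (intro exI[of _ "- (Fin ` cball 0 b)"]) auto
    qed
  qed
qed

lemma pole_notin_basin:
  assumes "Fin z \<in> basin C (Fin \<zeta>)"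
  shows "poly D z \<noteq> 0"
proof
  assume "poly D z = 0"
  then have "Infty \<in> basin C (Fin \<zeta>)"
    using assms basin_step_iff[of C "Fin z"] by (simp add: C_Fin)
  then show False
    using fixpoint_in_basin_iff[of C Infty] C_Infty by simp
qed

lemma Infty_notin_basin: "Infty \<notin> basin C (Fin \<zeta>)"
  using fixpoint_in_basin_iff[of C Infty] C_Infty by simp

text \<open>Represents \<open>C\<close> in the affine chart only off the poles; at a pole, division
  by zero gives the default 0.\<close>

definition finite_part :: "complex \<Rightarrow> complex" where
  "finite_part z = poly N z / poly D z"

lemma holomorphic_finite_part: "finite_part holomorphic_on {z. poly D z \<noteq> 0}"
  unfolding finite_part_def by (intro holomorphic_intros) auto

lemma open_nonpoles: "open {z. poly D z \<noteq> 0}"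
  by (intro open_Collect_neq continuous_intros)

end

locale attracting_fixpoint = rational_sphere_map +
  fixes \<zeta> :: complex
  assumes nonpole: "poly D \<zeta> \<noteq> 0" and fixed: "finite_part \<zeta> = \<zeta>"
    and attracting: "cmod (deriv finite_part \<zeta>) < 1"
begin

text \<open>Any \<open>q\<close> strictly between the modulus of the multiplier and 1 bounds the
  difference quotient near \<zeta>.\<close>

lemma contracting_ball:
  obtains \<rho> q where "0 < \<rho>" "0 < q" "q < 1"
    "\<And>z. z \<in> ball \<zeta> \<rho> \<Longrightarrow> poly D z \<noteq> 0 \<and> cmod (finite_part z - \<zeta>) \<le> q * cmod (z - \<zeta>)"
proof -
  obtain q where q: "cmod (deriv finite_part \<zeta>) < q" "q < 1"
    using attracting dense by blast
  have q0: "0 < q" using q(1) norm_ge_zero[of "deriv finite_part \<zeta>"] by linarith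
  have "(finite_part has_field_derivative deriv finite_part \<zeta>) (at \<zeta>)"
    using holomorphic_derivI[OF holomorphic_finite_part open_nonpoles] nonpole by simp
  then have "((\<lambda>z. (finite_part z - \<zeta>) / (z - \<zeta>)) \<longlongrightarrow> deriv finite_part \<zeta>) (at \<zeta>)"
    by (simp add: has_field_derivative_iff fixed)
  then have "\<forall>\<^sub>F z in at \<zeta>. cmod ((finite_part z - \<zeta>) / (z - \<zeta>)) < q"
    using order_tendstoD(2)[OF tendsto_norm] q(1) by blast
  then obtain d where d: "d > 0"
    "\<And>z. z \<noteq> \<zeta> \<Longrightarrow> dist z \<zeta> < d \<Longrightarrow> cmod ((finite_part z - \<zeta>) / (z - \<zeta>)) < q"
    unfolding eventually_at by blast
  obtain e where e: "e > 0" "ball \<zeta> e \<subseteq> {z. poly D z \<noteq> 0}"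
    using open_nonpoles nonpole open_contains_ball by blast
  show ?thesis
  proof (rule that[of "min d e" q])
    fix z assume z: "z \<in> ball \<zeta> (min d e)"
    have "cmod (finite_part z - \<zeta>) \<le> q * cmod (z - \<zeta>)"
    proof (cases "z = \<zeta>")
      case False
      then show ?thesis
        using d(2)[of z] z by (simp add: dist_commute norm_divide divide_less_eq)
    qed (simp add: fixed)
    then show "poly D z \<noteq> 0 \<and> cmod (finite_part z - \<zeta>) \<le> q * cmod (z - \<zeta>)"
      using e(2) z by auto
  qed (use d e q q0 in auto)
qed

text \<open>The radius is fixed once by choice, so that the definitions depending on the disc can
  refer to it.\<close>

definition \<rho> :: real where
  "\<rho> = (SOME \<rho>. 0 < \<rho> \<and> (\<exists>q. 0 < q \<and> q < 1 \<and> (\<forall>z\<in>ball \<zeta> \<rho>.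
      poly D z \<noteq> 0 \<and> cmod (finite_part z - \<zeta>) \<le> q * cmod (z - \<zeta>))))"

lemma \<rho>: "0 < \<rho>" "\<exists>q. 0 < q \<and> q < 1 \<and> (\<forall>z\<in>ball \<zeta> \<rho>.
      poly D z \<noteq> 0 \<and> cmod (finite_part z - \<zeta>) \<le> q * cmod (z - \<zeta>))"
proof -
  have "0 < \<rho> \<and> (\<exists>q. 0 < q \<and> q < 1 \<and> (\<forall>z\<in>ball \<zeta> \<rho>.
      poly D z \<noteq> 0 \<and> cmod (finite_part z - \<zeta>) \<le> q * cmod (z - \<zeta>)))"
    unfolding \<rho>_def by (rule someI_ex) (metis contracting_ball)
  then show "0 < \<rho>" "\<exists>q. 0 < q \<and> q < 1 \<and> (\<forall>z\<in>ball \<zeta> \<rho>.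
      poly D z \<noteq> 0 \<and> cmod (finite_part z - \<zeta>) \<le> q * cmod (z - \<zeta>))" by blast+
qed

text \<open>After \<open>n\<close> steps the distance to \<zeta> is at most
  \<open>q ^ n * \<rho>\<close>, uniformly on the disc; continuity of \<open>Fin\<close> turns this
  into chordal distance.\<close>

lemma attracting_neighbourhood_ball: "attracting_neighbourhood C (Fin \<zeta>) (Fin ` ball \<zeta> \<rho>)"
proof
  obtain q where q: "0 < q" "q < 1"
    "\<And>z. z \<in> ball \<zeta> \<rho> \<Longrightarrow> poly D z \<noteq> 0 \<and> cmod (finite_part z - \<zeta>) \<le> q * cmod (z - \<zeta>)"
    using \<rho>(2) by blast
  have iter: "\<exists>w. (C ^^ n) (Fin z) = Fin w \<and> w \<in> ball \<zeta> \<rho> \<and> cmod (w - \<zeta>) \<le> q ^ n * cmod (z - \<zeta>)"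
    if "z \<in> ball \<zeta> \<rho>" for z n
  proof (induction n)
    case 0
    then show ?case using that by simp
  next
    case (Suc n)
    then obtain w where w: "(C ^^ n) (Fin z) = Fin w" "w \<in> ball \<zeta> \<rho>" "cmod (w - \<zeta>) \<le> q ^ n * cmod (z - \<zeta>)"
      by blast
    have "C (Fin w) = Fin (finite_part w)" using q(3)[OF w(2)] by (simp add: C_Fin finite_part_def)
    moreover have le: "cmod (finite_part w - \<zeta>) \<le> q * cmod (w - \<zeta>)" using q(3)[OF w(2)] by blast
    moreover have "q * cmod (w - \<zeta>) \<le> 1 * cmod (w - \<zeta>)" using q(2) by (intro mult_right_mono) auto
    then have "finite_part w \<in> ball \<zeta> \<rho>"
      using le w(2) by (simp add: dist_norm norm_minus_commute)
    moreover have "q * cmod (w - \<zeta>) \<le> q * (q ^ n * cmod (z - \<zeta>))"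
      using w(3) q(1) by (intro mult_left_mono) auto
    ultimately show ?case using w(1) by (auto simp: mult.assoc)
  qed
  show "uniform_limit (Fin ` ball \<zeta> \<rho>) (\<lambda>n. C ^^ n) (\<lambda>_. Fin \<zeta>) sequentially"
  proof (rule uniform_limitI)
    fix e :: real assume "e > 0"
    then obtain d where d: "d > 0" "\<And>w. dist w \<zeta> < d \<Longrightarrow> dist (Fin w) (Fin \<zeta>) < e"
      using continuous_on_Fin[of UNIV] unfolding continuous_on_iff by blast
    have "(\<lambda>n. q ^ n * \<rho>) \<longlonglongrightarrow> 0 * \<rho>"
      using q by (intro tendsto_intros LIMSEQ_realpow_zero) auto
    then have "\<forall>\<^sub>F n in sequentially. q ^ n * \<rho> < d"
      using d(1) order_tendstoD(2) by fastforce
    then show "\<forall>\<^sub>F n in sequentially. \<forall>x\<in>Fin ` ball \<zeta> \<rho>. dist ((C ^^ n) x) (Fin \<zeta>) < e"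
    proof (rule eventually_mono, safe)
      fix n z assume n: "q ^ n * \<rho> < d" and z: "z \<in> ball \<zeta> \<rho>"
      obtain w where w: "(C ^^ n) (Fin z) = Fin w" "cmod (w - \<zeta>) \<le> q ^ n * cmod (z - \<zeta>)"
        using iter[OF z] by blast
      have "q ^ n * cmod (z - \<zeta>) \<le> q ^ n * \<rho>"
        using z q(1) by (intro mult_left_mono) (auto simp: dist_norm norm_minus_commute)
      then have "dist w \<zeta> < d" using w(2) n by (simp add: dist_norm)
      then show "dist ((C ^^ n) (Fin z)) (Fin \<zeta>) < e" using d(2) w(1) by simp
    qed
  qed
  show "continuous_on UNIV C" by (rule continuous_on_C)
  show "open (Fin ` ball \<zeta> \<rho>)" by (intro open_Fin_image) simp
  show "Fin \<zeta> \<in> Fin ` ball \<zeta> \<rho>" using \<rho>(1) by simp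
qed

lemma C_ball: "x \<in> Fin ` ball \<zeta> \<rho> \<Longrightarrow> C x \<in> Fin ` ball \<zeta> \<rho>"
proof safe
  fix z assume z: "z \<in> ball \<zeta> \<rho>"
  obtain q where q: "q < 1" "poly D z \<noteq> 0" "cmod (finite_part z - \<zeta>) \<le> q * cmod (z - \<zeta>)"
    using \<rho>(2) z by blast
  have "q * cmod (z - \<zeta>) \<le> 1 * cmod (z - \<zeta>)" using q(1) by (intro mult_right_mono) auto
  then have "finite_part z \<in> ball \<zeta> \<rho>"
    using q(3) z by (simp add: dist_norm norm_minus_commute)
  then show "C (Fin z) \<in> Fin ` ball \<zeta> \<rho>" using q(2) by (simp add: C_Fin finite_part_def)
qed

interpretation attracting_neighbourhood C "Fin \<zeta>" "Fin ` ball \<zeta> \<rho>"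
  by (rule attracting_neighbourhood_ball)

section \<open>Iterates in the affine chart\<close>

definition iterate :: "nat \<Rightarrow> complex \<Rightarrow> complex" where
  "iterate n z = the_Fin ((C ^^ n) (Fin z))"

abbreviation "Z \<equiv> Fin -` basin C (Fin \<zeta>)"

text \<open>Orbits in the basin never reach infinity, so the default value of \<open>the_Fin\<close>
  does not intervene.\<close>

lemma Fin_iterate: "z \<in> Z \<Longrightarrow> (C ^^ n) (Fin z) = Fin (iterate n z)"
  using basin_funpow_iff[of n C "Fin z" "Fin \<zeta>"] Infty_notin_basin
  by (cases "(C ^^ n) (Fin z)") (auto simp: iterate_def)

lemma iterate_in_Z: "z \<in> Z \<Longrightarrow> iterate n z \<in> Z"
  using basin_funpow_iff[of n C "Fin z" "Fin \<zeta>"] Fin_iterate[of z n] by simp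

lemma iterate_0 [simp]: "iterate 0 z = z"
  by (simp add: iterate_def)

lemma iterate_Suc:
  assumes "z \<in> Z"
  shows "iterate (Suc n) z = finite_part (iterate n z)"
proof -
  have "poly D (iterate n z) \<noteq> 0"
    using pole_notin_basin[of "iterate n z" \<zeta>] iterate_in_Z[OF assms] by simp
  moreover have "iterate (Suc n) z = the_Fin (C (Fin (iterate n z)))"
    using Fin_iterate[OF assms, of n] by (simp add: iterate_def[of "Suc n"])
  ultimately show ?thesis by (simp add: C_Fin finite_part_def)
qed

lemma open_Z: "open Z"
proof -
  have "basin C (Fin \<zeta>) = (\<Union>n. (C ^^ n) -` (Fin ` ball \<zeta> \<rho>))"
    using basin_iff by auto
  moreover have "open (\<Union>n. (C ^^ n) -` (Fin ` ball \<zeta> \<rho>))"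
    by (intro open_UN ballI open_vimage openB continuous_on_funpow continuous_on_C)
  ultimately show ?thesis by (simp add: open_vimage_Fin)
qed

lemma holomorphic_iterate: "iterate n holomorphic_on Z"
proof (induction n)
  case 0
  show ?case by (rule holomorphic_transform[OF holomorphic_on_ident]) simp
next
  case (Suc n)
  have "(finite_part \<circ> iterate n) holomorphic_on Z"
    using Suc holomorphic_finite_part
    by (rule holomorphic_on_compose_gen) (use iterate_in_Z pole_notin_basin in blast)
  then show ?case
    by (rule holomorphic_transform) (simp add: iterate_Suc)
qed

lemma deriv_iterate_Suc:
  assumes "z \<in> Z"
  shows "deriv (iterate (Suc n)) z = deriv finite_part (iterate n z) * deriv (iterate n) z"
proof -
  have "(iterate n has_field_derivative deriv (iterate n) z) (at z)"
    using holomorphic_derivI[OF holomorphic_iterate open_Z assms] by simp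
  moreover have "(finite_part has_field_derivative deriv finite_part (iterate n z)) (at (iterate n z))"
    using holomorphic_derivI[OF holomorphic_finite_part open_nonpoles]
      pole_notin_basin[of "iterate n z" \<zeta>] iterate_in_Z[OF assms] by simp
  ultimately have "((\<lambda>z. finite_part (iterate n z)) has_field_derivative
      deriv finite_part (iterate n z) * deriv (iterate n) z) (at z)"
    using DERIV_chain2 by blast
  then have "(iterate (Suc n) has_field_derivative
      deriv finite_part (iterate n z) * deriv (iterate n) z) (at z)"
    by (rule has_field_derivative_transform_within_open[OF _ open_Z assms]) (simp add: iterate_Suc)
  then show ?thesis by (rule DERIV_imp_deriv)
qed

text \<open>By the chain rule, the orbit of a critical point of the iterate passes through a
  critical point of \<open>finite_part\<close>. In the basin this can only be \<zeta>, where the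
  orbit then stays.\<close>

lemma deriv_iterate_eq_0:
  assumes crit: "\<And>w. w \<in> Z \<Longrightarrow> deriv finite_part w = 0 \<Longrightarrow> w = \<zeta>"
  shows "z \<in> Z \<Longrightarrow> deriv (iterate n) z = 0 \<Longrightarrow> iterate n z = \<zeta>"
proof (induction n)
  case 0
  have "iterate 0 = (\<lambda>z. z)" by auto
  then show ?case using 0 by simp
next
  case (Suc n)
  then have "iterate n z = \<zeta>"
    using crit[of "iterate n z"] iterate_in_Z[of z n] by (auto simp: deriv_iterate_Suc)
  then show ?case using Suc.prems by (simp add: iterate_Suc fixed)
qed

section \<open>Exhaustion of the basin component by proper preimages of a disc\<close>

definition G :: "nat \<Rightarrow> complex set" where
  "G n = Fin -` ((C ^^ n) -` (Fin ` ball \<zeta> \<rho>))"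

lemma open_G: "open (G n)"
  unfolding G_def by (intro open_vimage_Fin open_vimage openB continuous_on_funpow continuous_on_C)

lemma incseq_G: "incseq G"
  by (rule incseq_SucI) (use C_ball in \<open>auto simp: G_def\<close>)

lemma UN_G: "(\<Union>n. G n) = Z"
  using basin_iff by (auto simp: G_def)

lemma centre_in_G: "\<zeta> \<in> G n"
  using \<rho>(1) C_Fin[of \<zeta>] nonpole fixed funpow_fixpoint[of C "Fin \<zeta>" n] by (simp add: G_def finite_part_def)

lemma iterate_centre: "iterate n \<zeta> = \<zeta>"
  using C_Fin[of \<zeta>] nonpole fixed funpow_fixpoint[of C "Fin \<zeta>" n] by (simp add: iterate_def finite_part_def)

definition W :: "nat \<Rightarrow> complex set" where
  "W n = connected_component_set (G n) \<zeta>"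

lemma W_subset: "W n \<subseteq> G n" "W n \<subseteq> Z"
proof -
  show "W n \<subseteq> G n"
    unfolding W_def by (rule connected_component_subset)
  then show "W n \<subseteq> Z"
    unfolding UN_G[symmetric] by blast
qed

lemma open_W: "open (W n)"
  unfolding W_def using open_G by (rule open_connected_component)

lemma incseq_W: "incseq W"
  using incseq_G unfolding incseq_def W_def by (intro allI impI connected_component_mono) auto

text \<open>The preimage of \<open>K\<close> under the iterate on the sphere is closed and misses
  infinity, because infinity is fixed; so it is compact in the plane. It lies in \<open>G n\<close>,
  in which the component \<open>W n\<close> is relatively closed.\<close>

lemma compact_W_Int_iterate:
  assumes K: "compact K" "K \<subseteq> ball \<zeta> \<rho>"
  shows "compact (W n \<inter> iterate n -` K)"
proof -
  define S where "S = (C ^^ n) -` (Fin ` K)"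
  have "closed S"
    unfolding S_def using K(1)
    by (intro closed_vimage continuous_on_funpow continuous_on_C compact_imp_closed
        compact_continuous_image continuous_on_Fin)
  moreover have "Infty \<notin> S"
    using funpow_fixpoint[of C, OF C_Infty] by (auto simp: S_def)
  ultimately have "compact (Fin -` S)"
    by (simp add: compact_eq_bounded_closed bounded_vimage_Fin closed_vimage_Fin)
  have "Fin -` S \<subseteq> G n" using K(2) by (auto simp: S_def G_def)
  obtain T where T: "closed T" "W n = G n \<inter> T"
    unfolding W_def using closedin_connected_component[of "G n" \<zeta>] by (auto simp: closedin_closed)
  have "W n \<inter> iterate n -` K = W n \<inter> Fin -` S"
    using Fin_iterate W_subset(2) by (fastforce simp: S_def)
  also have "\<dots> = Fin -` S \<inter> T" using T(2) \<open>Fin -` S \<subseteq> G n\<close> by blast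
  finally show ?thesis
    using compact_Int_closed[OF \<open>compact (Fin -` S)\<close> T(1)] by simp
qed

lemma simply_connected_W:
  assumes crit: "\<And>w. w \<in> Z \<Longrightarrow> deriv finite_part w = 0 \<Longrightarrow> w = \<zeta>"
  shows "simply_connected (W n)"
proof (rule simply_connected_proper_holomorphic_preimage_ball)
  \<comment> \<open>Translated so that the target disc is centred at 0 and the only possible
    critical value \<zeta> becomes 0.\<close>
  let ?F = "\<lambda>z. iterate n z - \<zeta>"
  have hol: "iterate n holomorphic_on W n"
    using holomorphic_iterate W_subset(2) by (rule holomorphic_on_subset)
  then show "?F holomorphic_on W n" by (intro holomorphic_intros)
  show "open (W n)" by (rule open_W)
  show "connected (W n)" by (simp add: W_def)
  show "?F ` W n \<subseteq> ball 0 \<rho>"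
  proof safe
    fix z assume "z \<in> W n"
    then have "Fin (iterate n z) \<in> Fin ` ball \<zeta> \<rho>"
      using W_subset[of n] Fin_iterate[of z n] unfolding G_def by fastforce
    then show "?F z \<in> ball 0 \<rho>" by (auto simp: dist_norm norm_minus_commute)
  qed
  show "compact (W n \<inter> ?F -` K)" if "compact K" "K \<subseteq> ball 0 \<rho>" for K
  proof -
    have "compact ((+) \<zeta> ` K)" using that(1) by (rule compact_translation)
    moreover have "(+) \<zeta> ` K \<subseteq> ball \<zeta> \<rho>" using that(2) by (auto simp: dist_norm)
    moreover have "?F -` K = iterate n -` ((+) \<zeta> ` K)"
      by (force simp: image_iff algebra_simps)
    ultimately show ?thesis using compact_W_Int_iterate by simp
  qed
  show "?F z = 0" if "z \<in> W n" "deriv ?F z = 0" for z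
  proof -
    have "(iterate n has_field_derivative deriv (iterate n) z) (at z)"
      using holomorphic_derivI[OF hol open_W that(1)] by simp
    then have "(?F has_field_derivative deriv (iterate n) z) (at z)"
      by (auto intro!: derivative_eq_intros)
    then have "deriv (iterate n) z = 0" using that(2) DERIV_imp_deriv by metis
    then show ?thesis
      using deriv_iterate_eq_0[OF crit, of z n] W_subset(2) that(1) by auto
  qed
  show "\<zeta> \<in> W n" using centre_in_G by (simp add: W_def)
  show "?F \<zeta> = 0" by (simp add: iterate_centre)
qed

text \<open>A path from \<zeta> within the basin is compact and so lies in one \<open>G n\<close>;
  being connected and containing \<zeta>, it lies in \<open>W n\<close>.\<close>

lemma UN_W: "(\<Union>n. W n) = connected_component_set Z \<zeta>"
proof
  have "G n \<subseteq> Z" for n using UN_G by blast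
  then show "(\<Union>n. W n) \<subseteq> connected_component_set Z \<zeta>"
    unfolding W_def using connected_component_mono by blast
  show "connected_component_set Z \<zeta> \<subseteq> (\<Union>n. W n)"
  proof
    let ?A = "connected_component_set Z \<zeta>"
    fix z assume z: "z \<in> ?A"
    have "path_connected ?A"
      by (intro connected_open_path_connected open_connected_component open_Z) simp
    moreover have "\<zeta> \<in> ?A" using centre_in_G UN_G by auto
    ultimately obtain g where g: "path g" "path_image g \<subseteq> ?A" "pathstart g = \<zeta>" "pathfinish g = z"
      using z unfolding path_connected_def by blast
    have "path_image g \<subseteq> (\<Union>n. G n)"
      using g(2) connected_component_subset[of Z] unfolding UN_G by blast
    then obtain n where "path_image g \<subseteq> G n"
      using compact_subset_incseq_open[OF compact_path_image[OF g(1)] _ open_G incseq_G] by blast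
    then have "path_image g \<subseteq> W n"
      unfolding W_def using g
      by (intro connected_component_maximal connected_path_image) auto
    then show "z \<in> (\<Union>n. W n)" using g(4) pathfinish_in_path_image by blast
  qed
qed

lemma immediate_basin_eq_Fin_image:
  "immediate_basin C (Fin \<zeta>) = Fin ` connected_component_set Z \<zeta>"
proof -
  have eq: "connected_component_set (basin C (Fin \<zeta>)) (Fin \<zeta>) = Fin ` connected_component_set Z \<zeta>"
    using Infty_notin_basin by (rule connected_component_Fin)
  show ?thesis
    using immediate_basin_eq open_Fin_image[OF open_connected_component[OF open_Z]] by (simp only: eq)
qed

lemma immediate_basin_subset_basin: "immediate_basin C (Fin \<zeta>) \<subseteq> basin C (Fin \<zeta>)"
  unfolding immediate_basin_eq_Fin_image using connected_component_subset[of Z \<zeta>] by auto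

lemma fixpoint_in_immediate_basin: "Fin \<zeta> \<in> immediate_basin C (Fin \<zeta>)"
  unfolding immediate_basin_eq_Fin_image using centre_in_G UN_G
  by (intro imageI) (simp del: vimage_eq, blast)

theorem simply_connected_immediate_basin:
  assumes "\<And>w. Fin w \<in> basin C (Fin \<zeta>) \<Longrightarrow> deriv finite_part w = 0 \<Longrightarrow> w = \<zeta>"
  shows "simply_connected (immediate_basin C (Fin \<zeta>))"
  unfolding immediate_basin_eq_Fin_image UN_W[symmetric]
  using assms by (intro simply_connected_Fin_image simply_connected_incseq_Union
      simply_connected_W open_W incseq_W) auto

end

section \<open>The quartic family\<close>

text \<open>Both the given pair and the normalised pair \<open>(P, Q)\<close> are free of common
  zeros and satisfy \<open>P * D = N * Q\<close>. Hence the denominators vanish at the same points,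
  the quotients agree elsewhere, and the degree differences are equal.\<close>

lemma rational_map_to_fract:
  assumes ncr: "\<And>z. poly D z \<noteq> 0 \<or> poly N z \<noteq> 0" and deg: "degree D < degree N" and D0: "D \<noteq> 0"
  shows "rational_sphere_map (rational_map (to_fract N / to_fract D)) N D"
proof -
  obtain P Q where PQ: "quot_of_fract (to_fract N / to_fract D) = (P, Q)" by (metis surj_pair)
  have Q0: "Q \<noteq> 0" using snd_quot_of_fract_nonzero[of "to_fract N / to_fract D"] PQ by simp
  have "to_fract P / to_fract Q = to_fract N / to_fract D"
    using Fract_quot_of_fract[of "to_fract N / to_fract D"] PQ by (simp add: Fract_conv_to_fract)
  then have "to_fract (P * D) = to_fract (N * Q)"
    using Q0 D0 by (simp add: frac_eq_eq)
  then have cross: "P * D = N * Q" by (simp only: to_fract_eq_iff)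
  have N0: "N \<noteq> 0" using deg by auto
  have P0: "P \<noteq> 0" using cross N0 Q0 by auto
  have "coprime P Q" using coprime_quot_of_fract[of "to_fract N / to_fract D"] PQ by simp
  have ncr': "poly P z \<noteq> 0 \<or> poly Q z \<noteq> 0" for z
  proof (rule ccontr)
    assume "\<not> ?thesis"
    then have "[:- z, 1:] dvd P" "[:- z, 1:] dvd Q" by (simp_all add: poly_eq_0_iff_dvd)
    then have "is_unit [:- z, 1:]" using \<open>coprime P Q\<close> by (rule coprime_common_divisor[rotated])
    then show False by (simp add: is_unit_iff_degree)
  qed
  have "degree P + degree D = degree N + degree Q"
    using cross P0 N0 D0 Q0 by (metis degree_mult_eq)
  then have degPQ: "degree Q < degree P" using deg by linarith
  have crossz: "poly P z * poly D z = poly N z * poly Q z" for z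
    using cross by (metis poly_mult)
  show ?thesis
  proof
    show "rational_map (to_fract N / to_fract D) (Fin z) =
        (if poly D z = 0 then Infty else Fin (poly N z / poly D z))" for z
    proof -
      have "poly Q z = 0 \<longleftrightarrow> poly D z = 0"
        using crossz[of z] ncr[of z] ncr'[of z] by auto
      then show ?thesis
        using crossz[of z] by (simp add: rational_map_def PQ frac_eq_eq)
    qed
    show "rational_map (to_fract N / to_fract D) Infty = Infty"
      using degPQ by (simp add: rational_map_def PQ)
  qed (use ncr deg in auto)
qed

text \<open>Clears denominators by an identity between generic elements of a field in which 2 is
  nonzero, then instantiates it with polynomial fractions.\<close>

lemma chebyshev_fract_eq:
  assumes "pderiv p \<noteq> 0"
  shows "chebyshev_fract p =
    to_fract (2 * [:0, 1:] * pderiv p ^ 3 - 2 * p * pderiv p ^ 2 - p ^ 2 * pderiv (pderiv p)) /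
    to_fract (2 * pderiv p ^ 3)"
proof -
  have eq: "x - (1 + 1/2 * (u * w / v\<^sup>2)) * (u / v) = (2 * x * v ^ 3 - 2 * u * v\<^sup>2 - u\<^sup>2 * w) / (2 * v ^ 3)"
    if "v \<noteq> 0" "(2::'f) \<noteq> 0" for x u v w :: "'f::field"
    using that by (simp add: field_simps power2_eq_square power3_eq_cube)
  have two: "to_fract (2 :: complex poly) = 2"
    using to_fract_add[of "1 :: complex poly" 1] by (simp del: to_fract_add)
  have pow: "to_fract (q ^ n) = to_fract q ^ n" for q :: "complex poly" and n
    by (induction n) simp_all
  have ne: "to_fract (pderiv p) \<noteq> 0" "(2 :: complex poly fract) \<noteq> 0"
    using assms two by (simp, metis to_fract_eq_0_iff zero_neq_numeral)
  show ?thesis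
    by (simp only: chebyshev_fract_def chebyshev_L_def eq[OF ne] to_fract_mult to_fract_diff two pow)
qed

locale chebyshev_quartic =
  fixes a :: real
  assumes a: "0 < a" "a < 1"
begin

definition C :: "riemann_sphere \<Rightarrow> riemann_sphere" where
  "C = chebyshev_method (quartic (complex_of_real a))"

abbreviation p :: "complex poly" where "p \<equiv> quartic (complex_of_real a)"

abbreviation b :: complex where "b \<equiv> 1 + complex_of_real a"

lemma p_eq: "p = [:of_real a, 0, - b, 0, 1:]"
  by (simp add: quartic_def power2_eq_square one_pCons)

lemma pderiv_p: "pderiv p = [:0, - 2 * b, 0, 4:]"
  unfolding p_eq by (simp add: pderiv_pCons)

lemma pderiv2_p: "pderiv (pderiv p) = [:- 2 * b, 0, 12:]"
  unfolding pderiv_p by (simp add: pderiv_pCons)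

lemma pderiv3_p: "pderiv (pderiv (pderiv p)) = [:0, 24:]"
  unfolding pderiv2_p by (simp add: pderiv_pCons)

lemma poly_p: "poly p z = (z\<^sup>2 - 1) * (z\<^sup>2 - of_real a)"
  by (simp add: quartic_def)

lemma poly_pderiv_p: "poly (pderiv p) z = 2 * z * (2 * z\<^sup>2 - b)"
  unfolding pderiv_p by (simp add: power2_eq_square algebra_simps)

lemma poly_pderiv2_p: "poly (pderiv (pderiv p)) z = 12 * z\<^sup>2 - 2 * b"
  unfolding pderiv2_p by (simp add: power2_eq_square algebra_simps)

section \<open>Numerator and denominator for the quartic\<close>

definition N :: "complex poly" where
  "N = 2 * [:0, 1:] * pderiv p ^ 3 - 2 * p * pderiv p ^ 2 - p ^ 2 * pderiv (pderiv p)"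

definition D :: "complex poly" where
  "D = 2 * pderiv p ^ 3"

lemma b_nonzero: "b \<noteq> 0"
proof -
  have "complex_of_real (1 + a) \<noteq> 0"
    unfolding of_real_eq_0_iff using a by linarith
  then show ?thesis by simp
qed

lemma poly_D_eq_0_iff: "poly D z = 0 \<longleftrightarrow> poly (pderiv p) z = 0"
  by (simp add: D_def)

text \<open>Where \<open>p' = 0\<close>, the numerator reduces to \<open>- p^2 p''\<close>. The
  zeros of \<open>p'\<close> are 0 and the square roots of \<open>b / 2\<close>; at them
  \<open>p\<close> equals \<open>a\<close> or \<open>- ((1 - a) / 2)^2\<close>, and
  \<open>p''\<close> equals \<open>- 2 b\<close> or \<open>4 b\<close>, all nonzero.\<close>

lemma no_common_root: "poly D z \<noteq> 0 \<or> poly N z \<noteq> 0"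
proof (rule ccontr)
  assume "\<not> ?thesis"
  then have D: "poly (pderiv p) z = 0" and "poly N z = 0" by (auto simp: poly_D_eq_0_iff)
  then have N: "poly p z = 0 \<or> poly (pderiv (pderiv p)) z = 0" by (simp add: N_def)
  from D have "z = 0 \<or> 2 * z\<^sup>2 = b" by (auto simp: poly_pderiv_p)
  then have "z = 0 \<or> z\<^sup>2 = b / 2"
    by (metis nonzero_mult_div_cancel_left zero_neq_numeral)
  then show False
  proof
    assume "z = 0"
    then show False using N a b_nonzero by (auto simp: poly_p poly_pderiv2_p)
  next
    assume z: "z\<^sup>2 = b / 2"
    have "poly p z = - ((1 - of_real a) / 2)\<^sup>2"
      unfolding poly_p z by (simp add: power2_eq_square field_simps)
    moreover have "complex_of_real (1 - a) \<noteq> 0"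
      unfolding of_real_eq_0_iff using a by linarith
    ultimately have "poly p z \<noteq> 0" by simp
    moreover have "poly (pderiv (pderiv p)) z = 4 * b"
      unfolding poly_pderiv2_p z by (simp add: field_simps)
    then have "poly (pderiv (pderiv p)) z \<noteq> 0"
      using b_nonzero by (simp only: mult_eq_0_iff zero_neq_numeral[symmetric]) simp
    ultimately show False using N by blast
  qed
qed

text \<open>The three summands of \<open>N\<close> have degree 10 with leading coefficients 128, 32
  and 12; since 128 - 32 - 12 = 84, the top terms do not cancel, whereas \<open>D\<close> has degree
  9.\<close>

lemma degree_D_less: "degree D < degree N"
proof -
  have deg: "degree p = 4" "degree (pderiv p) = 3" "degree (pderiv (pderiv p)) = 2"
    and lc: "coeff p 4 = 1" "coeff (pderiv p) 3 = 4" "coeff (pderiv (pderiv p)) 2 = 12"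
  proof -
    show "degree p = 4" "coeff p 4 = 1"
      unfolding p_eq by (simp_all add: numeral_eq_Suc)
    show "degree (pderiv (pderiv p)) = 2" "coeff (pderiv (pderiv p)) 2 = 12"
      unfolding pderiv2_p by (simp_all add: numeral_eq_Suc)
    show "degree (pderiv p) = 3" "coeff (pderiv p) 3 = 4"
      unfolding pderiv_p by (simp_all add: numeral_eq_Suc)
  qed
  have nz: "p \<noteq> 0" "pderiv p \<noteq> 0" "pderiv (pderiv p) \<noteq> 0" using deg by auto
  have two: "(2 :: complex poly) = [:2:]" by (simp add: numeral_poly)
  have "degree (2 * [:0, 1:] * pderiv p ^ 3) = 10" "degree (2 * p * pderiv p ^ 2) = 10"
    "degree (p ^ 2 * pderiv (pderiv p)) = 10"
    using nz deg by (simp_all add: degree_mult_eq degree_power_eq two)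
  moreover have "lead_coeff (2 * [:0, 1:] * pderiv p ^ 3) = 128" "lead_coeff (2 * p * pderiv p ^ 2) = 32"
    "lead_coeff (p ^ 2 * pderiv (pderiv p)) = 12"
    using deg lc by (simp_all only: lead_coeff_mult lead_coeff_power two) simp_all
  ultimately have "coeff N 10 = 84"
    unfolding N_def by simp
  then have "10 \<le> degree N" by (intro le_degree) simp
  moreover have "degree D = 9"
    using nz deg by (simp add: D_def degree_mult_eq degree_power_eq two)
  ultimately show ?thesis by simp
qed

lemma C_eq: "C = rational_map (to_fract N / to_fract D)"
proof -
  have "pderiv p \<noteq> 0" unfolding pderiv_p by simp
  then show ?thesis
    by (simp add: C_def chebyshev_method_def chebyshev_fract_eq N_def D_def)
qed

sublocale rational_sphere_map C N D
  unfolding C_eq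
proof (rule rational_map_to_fract[OF no_common_root degree_D_less])
  show "D \<noteq> 0" by (simp add: D_def pderiv_p)
qed

section \<open>Derivative and critical points\<close>

lemma finite_part_eq:
  assumes "poly (pderiv p) z \<noteq> 0"
  shows "finite_part z = z - poly p z / poly (pderiv p) z
    - (poly p z)\<^sup>2 * poly (pderiv (pderiv p)) z / (2 * poly (pderiv p) z ^ 3)"
proof -
  have eq: "(2 * x * u1 ^ 3 - 2 * u * u1\<^sup>2 - u\<^sup>2 * u2) / (2 * u1 ^ 3) = x - u / u1 - u\<^sup>2 * u2 / (2 * u1 ^ 3)"
    if "u1 \<noteq> 0" for x u u1 u2 :: complex
    using that by (simp add: field_simps power2_eq_square power3_eq_cube)
  have "poly N z = 2 * z * poly (pderiv p) z ^ 3 - 2 * poly p z * (poly (pderiv p) z)\<^sup>2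
      - (poly p z)\<^sup>2 * poly (pderiv (pderiv p)) z" "poly D z = 2 * poly (pderiv p) z ^ 3"
    by (simp_all add: N_def D_def)
  then show ?thesis
    using eq[OF assms] by (simp only: finite_part_def)
qed

text \<open>The derivative simplifies to \<open>p^2 (3 p''^2 - p' p''') / (2 p'^4)\<close>, and for
  this quartic \<open>3 p''^2 - p' p'''\<close> is 12 times the biquadratic factor.\<close>

lemma deriv_finite_part:
  assumes "poly (pderiv p) z \<noteq> 0"
  shows "deriv finite_part z =
    6 * (poly p z)\<^sup>2 * (28 * z ^ 4 - 8 * b * z\<^sup>2 + b\<^sup>2) / poly (pderiv p) z ^ 4"
proof -
  let ?f = "\<lambda>z. z - poly p z / poly (pderiv p) z
    - (poly p z)\<^sup>2 * poly (pderiv (pderiv p)) z / (2 * poly (pderiv p) z ^ 3)"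
  let ?u = "poly p z" and ?u1 = "poly (pderiv p) z" and ?u2 = "poly (pderiv (pderiv p)) z"
    and ?u3 = "poly (pderiv (pderiv (pderiv p))) z"
  \<comment> \<open>The left-hand side has the shape that the sum and quotient rules
    produce.\<close>
  have eq: "1 - (u1 * u1 - u * u2) / (u1 * u1)
     - ((2 * u * u1 * u2 + u ^ 2 * u3) * (2 * u1 ^ 3) - u ^ 2 * u2 * (6 * u1 ^ 2 * u2)) / ((2 * u1 ^ 3) * (2 * u1 ^ 3))
     = u\<^sup>2 * (3 * u2\<^sup>2 - u1 * u3) / (2 * u1 ^ 4)" if "u1 \<noteq> 0" for u u1 u2 u3 :: complex
    using that by (simp add: field_simps eval_nat_numeral)
  have "(?f has_field_derivative
     1 - (?u1 * ?u1 - ?u * ?u2) / (?u1 * ?u1)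
     - ((2 * ?u * ?u1 * ?u2 + ?u ^ 2 * ?u3) * (2 * ?u1 ^ 3) - ?u ^ 2 * ?u2 * (6 * ?u1 ^ 2 * ?u2)) / ((2 * ?u1 ^ 3) * (2 * ?u1 ^ 3))) (at z)"
    using assms by (auto intro!: derivative_eq_intros poly_DERIV simp: algebra_simps)
  then have "(?f has_field_derivative ?u\<^sup>2 * (3 * ?u2\<^sup>2 - ?u1 * ?u3) / (2 * ?u1 ^ 4)) (at z)"
    by (simp only: eq[OF assms])
  moreover have "3 * ?u2\<^sup>2 - ?u1 * ?u3 = 12 * (28 * z ^ 4 - 8 * b * z\<^sup>2 + b\<^sup>2)"
    unfolding poly_pderiv_p poly_pderiv2_p pderiv3_p
    by (simp add: algebra_simps power2_eq_square eval_nat_numeral)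
  moreover have "?u\<^sup>2 * (12 * E) / (2 * ?u1 ^ 4) = 6 * ?u\<^sup>2 * E / ?u1 ^ 4" for E
    by simp
  ultimately have "(?f has_field_derivative
     6 * ?u\<^sup>2 * (28 * z ^ 4 - 8 * b * z\<^sup>2 + b\<^sup>2) / ?u1 ^ 4) (at z)"
    by (simp only:)
  moreover have "open {z. poly (pderiv p) z \<noteq> 0}"
    using open_nonpoles by (simp add: poly_D_eq_0_iff)
  ultimately have "(finite_part has_field_derivative
     6 * ?u\<^sup>2 * (28 * z ^ 4 - 8 * b * z\<^sup>2 + b\<^sup>2) / ?u1 ^ 4) (at z)"
    by (rule has_field_derivative_transform_within_open) (use assms in \<open>simp_all add: finite_part_eq\<close>)
  then show ?thesis by (rule DERIV_imp_deriv)
qed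

lemma root_nonpole: "poly p z = 0 \<Longrightarrow> poly (pderiv p) z \<noteq> 0"
proof -
  assume "poly p z = 0"
  then have z: "z\<^sup>2 = 1 \<or> z\<^sup>2 = of_real a" by (auto simp: poly_p)
  then have "z \<noteq> 0" using a by auto
  moreover have "2 * z\<^sup>2 - b \<noteq> 0"
  proof -
    have "2 * z\<^sup>2 - b = of_real (1 - a) \<or> 2 * z\<^sup>2 - b = of_real (a - 1)"
      using z by auto
    moreover have "complex_of_real (1 - a) \<noteq> 0" "complex_of_real (a - 1) \<noteq> 0"
      unfolding of_real_eq_0_iff using a by linarith+
    ultimately show ?thesis by auto
  qed
  ultimately show ?thesis by (simp add: poly_pderiv_p)
qed

text \<open>The derivative carries the factor \<open>p^2\<close>, so the multiplier at a root is
  0.\<close>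

lemma attracting_fixpoint_root:
  assumes "poly p \<zeta> = 0"
  shows "attracting_fixpoint C N D \<zeta>"
proof
  show "poly D \<zeta> \<noteq> 0" using root_nonpole[OF assms] by (simp add: poly_D_eq_0_iff)
  show "finite_part \<zeta> = \<zeta>" using root_nonpole[OF assms] assms by (simp add: finite_part_eq)
  show "cmod (deriv finite_part \<zeta>) < 1"
    using root_nonpole[OF assms] assms by (simp add: deriv_finite_part)
qed

lemma C_root: "poly p w = 0 \<Longrightarrow> C (Fin w) = Fin w"
  using root_nonpole[of w] finite_part_eq[of w] C_Fin[of w]
  by (simp add: poly_D_eq_0_iff flip: finite_part_def)

text \<open>The free critical points: zeros of the remaining factor of the derivative.\<close>

definition crit :: "complex set" where
  "crit = {z. 28 * z ^ 4 - 8 * b * z\<^sup>2 + b\<^sup>2 = 0}"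

text \<open>A critical point in the basin is no pole, hence a root or free. Free ones are excluded
  by hypothesis, and another root, being fixed, does not converge to \<zeta>.\<close>

lemma simply_connected_immediate_basin_root:
  assumes \<zeta>: "poly p \<zeta> = 0" and crit: "\<And>w. w \<in> crit \<Longrightarrow> Fin w \<notin> basin C (Fin \<zeta>)"
  shows "simply_connected (immediate_basin C (Fin \<zeta>))"
proof -
  interpret attracting_fixpoint C N D \<zeta> using \<zeta> by (rule attracting_fixpoint_root)
  show ?thesis
  proof (rule simply_connected_immediate_basin)
    fix w assume w: "Fin w \<in> basin C (Fin \<zeta>)" "deriv finite_part w = 0"
    have "poly (pderiv p) w \<noteq> 0" using pole_notin_basin[OF w(1)] by (simp add: poly_D_eq_0_iff)
    then have "poly p w = 0 \<or> w \<in> crit"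
      using w(2) by (auto simp: deriv_finite_part crit_def)
    then have "poly p w = 0" using crit w(1) by blast
    then show "w = \<zeta>" using fixpoint_in_basin_iff[of C "Fin w" "Fin \<zeta>"] C_root w(1) by simp
  qed
qed

section \<open>Symmetries under negation and conjugation\<close>

lemma basin_sphere_map:
  assumes m: "linear m" "\<And>z. cmod (m z) = cmod z"
    and comm: "\<And>x. C (sphere_map m x) = sphere_map m (C x)"
    and x: "x \<in> basin C y"
  shows "sphere_map m x \<in> basin C (sphere_map m y)"
proof -
  have "(C ^^ n) (sphere_map m x) = sphere_map m ((C ^^ n) x)" for n
    by (induction n) (simp_all add: comm)
  moreover have "(\<lambda>n. sphere_map m ((C ^^ n) x)) \<longlonglongrightarrow> sphere_map m y"
    using x unfolding basin_def
    by (auto intro: continuous_on_tendsto_compose[OF continuous_on_sphere_map[OF m, of UNIV]])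
  ultimately show ?thesis by (simp add: basin_def)
qed

lemma C_commute:
  assumes m0: "\<And>z. poly (pderiv p) (m z) = 0 \<longleftrightarrow> poly (pderiv p) z = 0"
    and m1: "\<And>z. poly (pderiv p) z \<noteq> 0 \<Longrightarrow> finite_part (m z) = m (finite_part z)"
  shows "C (sphere_map m x) = sphere_map m (C x)"
  by (cases x) (simp_all add: C_Fin C_Infty poly_D_eq_0_iff m0 m1 flip: finite_part_def)

text \<open>\<open>p\<close> is even, so \<open>C\<close> is odd.\<close>

lemma basin_uminus: "Fin z \<in> basin C (Fin w) \<Longrightarrow> Fin (- z) \<in> basin C (Fin (- w))"
proof -
  assume "Fin z \<in> basin C (Fin w)"
  moreover have "C (sphere_map uminus x) = sphere_map uminus (C x)" for x
    by (rule C_commute)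
       (auto simp: finite_part_eq poly_p poly_pderiv_p poly_pderiv2_p)
  ultimately show ?thesis
    using basin_sphere_map[of uminus "Fin z" "Fin w"] linear_uminus by simp
qed

text \<open>\<open>p\<close> has real coefficients, so \<open>C\<close> commutes with
  conjugation.\<close>

lemma basin_cnj: "Fin z \<in> basin C (Fin w) \<Longrightarrow> Fin (cnj z) \<in> basin C (Fin (cnj w))"
proof -
  assume z: "Fin z \<in> basin C (Fin w)"
  have p': "poly (pderiv p) (cnj z) = cnj (poly (pderiv p) z)" for z
    by (simp add: poly_pderiv_p)
  have "C (sphere_map cnj x) = sphere_map cnj (C x)" for x
    by (rule C_commute)
       (auto simp: p' finite_part_eq poly_p poly_pderiv2_p)
  then show ?thesis
    using basin_sphere_map[of cnj "Fin z" "Fin w"] z bounded_linear.linear[OF bounded_linear_cnj] by simp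
qed

text \<open>The free critical points are non-real and form a single orbit under negation and conjugation,
  which permute the basins of the real roots: two such basins not exchanged by negation cannot both
  contain a free critical point.\<close>

lemma crit_orbit:
  assumes c: "c \<in> crit" and w: "w \<in> crit"
  shows "w = c \<or> w = - c \<or> w = cnj c \<or> w = - cnj c"
proof -
  \<comment> \<open>The biquadratic is a quadratic in the square of the variable, with real
    coefficients.\<close>
  define q where "q u = 28 * u\<^sup>2 - 8 * b * u + b\<^sup>2" for u
  have q: "q (z\<^sup>2) = 0" if "z \<in> crit" for z
    using that by (simp add: crit_def q_def flip: power_mult)
  \<comment> \<open>Vieta's formula for two distinct zeros.\<close>
  have sum: "28 * (u + v) = 8 * b" if "q u = 0" "q v = 0" "u \<noteq> v" for u v
  proof -
    have "(u - v) * (28 * (u + v) - 8 * b) = q u - q v"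
      by (simp add: q_def power2_eq_square algebra_simps)
    then show ?thesis using that by simp
  qed
  have cnjq: "q (cnj u) = 0" if "q u = 0" for u
  proof -
    have "q (cnj u) = cnj (q u)" by (simp add: q_def)
    then show ?thesis using that by simp
  qed
  have nonreal: "cnj u \<noteq> u" if "q u = 0" for u
  proof
    assume "cnj u = u"
    then obtain x where x: "u = of_real x" by (metis Reals_cases Reals_cnj_iff)
    \<comment> \<open>A sum of squares, vanishing only if \<open>x = 0\<close> and
      \<open>1 + a = 0\<close>.\<close>
    have "q u = of_real ((1 + a - 4 * x)\<^sup>2 + 12 * x\<^sup>2)"
      by (simp add: q_def x power2_eq_square algebra_simps)
    then have "complex_of_real ((1 + a - 4 * x)\<^sup>2 + 12 * x\<^sup>2) = 0"
      using that by (rule trans[OF sym])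
    then have "(1 + a - 4 * x)\<^sup>2 + 12 * x\<^sup>2 = 0" by (simp only: of_real_eq_0_iff)
    then have "x = 0" "1 + a - 4 * x = 0" by (simp_all add: add_nonneg_eq_0_iff)
    then show False using a by simp
  qed
  \<comment> \<open>The square of \<open>c\<close> and its conjugate are distinct zeros of
    \<open>q\<close>. A zero different from the conjugate has the same sum with it by Vieta, and so
    equals the square of \<open>c\<close>.\<close>
  have "w\<^sup>2 = c\<^sup>2 \<or> w\<^sup>2 = (cnj c)\<^sup>2"
  proof (rule disjCI)
    assume "w\<^sup>2 \<noteq> (cnj c)\<^sup>2"
    then have "28 * (w\<^sup>2 + cnj (c\<^sup>2)) = 8 * b"
      using sum[OF q[OF w] cnjq[OF q[OF c]]] by simp
    moreover have "28 * (c\<^sup>2 + cnj (c\<^sup>2)) = 8 * b"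
      using sum[OF q[OF c] cnjq[OF q[OF c]]] nonreal[OF q[OF c]] by metis
    ultimately have "28 * (w\<^sup>2 + cnj (c\<^sup>2)) = 28 * (c\<^sup>2 + cnj (c\<^sup>2))" by (rule trans[OF _ sym])
    then show "w\<^sup>2 = c\<^sup>2" by simp
  qed
  then show ?thesis by (auto simp: power2_eq_iff)
qed

lemma real_basins_crit_disjoint:
  fixes r s :: real
  assumes "r \<noteq> s" "r \<noteq> - s"
    and c: "c \<in> crit" "Fin c \<in> basin C (Fin (of_real r))"
    and w: "w \<in> crit" "Fin w \<in> basin C (Fin (of_real s))"
  shows False
proof -
  have "Fin (- c) \<in> basin C (Fin (of_real (- r)))" "Fin (cnj c) \<in> basin C (Fin (of_real r))"
    using basin_uminus[OF c(2)] basin_cnj[OF c(2)] by simp_all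
  moreover from this(2) have "Fin (- cnj c) \<in> basin C (Fin (of_real (- r)))"
    using basin_uminus by fastforce
  ultimately have "Fin w \<in> basin C (Fin (of_real r)) \<or> Fin w \<in> basin C (Fin (of_real (- r)))"
    using crit_orbit[OF c(1) w(1)] c(2) by blast
  moreover have "Fin (of_real r) \<noteq> Fin (of_real s)" "Fin (of_real (- r)) \<noteq> Fin (of_real s)"
    using assms(1,2) by (simp_all flip: of_real_minus)
  ultimately show False
    using w(2) basin_disjoint[of "Fin (of_real r)" "Fin (of_real s)" C]
      basin_disjoint[of "Fin (of_real (- r))" "Fin (of_real s)" C] by blast
qed

lemma two_simply_connected_basins:
  "card {B. (\<exists>\<zeta>\<in>{z. poly p z = 0}. B = immediate_basin C (Fin \<zeta>)) \<and> simply_connected B} \<ge> 2"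
proof -
  have "sqrt a \<noteq> 1" "sqrt a > 0" using a by simp_all
  then have "1 \<noteq> sqrt a" "1 \<noteq> - sqrt a" by linarith+
  \<comment> \<open>Were there free critical points in both basins,
    \<open>real_basins_crit_disjoint\<close> would be contradicted.\<close>
  then have "\<exists>r\<in>{1, sqrt a}. \<forall>w\<in>crit. Fin w \<notin> basin C (Fin (of_real r))"
    using real_basins_crit_disjoint[of 1 "sqrt a"] by blast
  then obtain r :: real where r: "r = 1 \<or> r = sqrt a"
    "\<And>w. w \<in> crit \<Longrightarrow> Fin w \<notin> basin C (Fin (of_real r))"
    by blast
  define \<zeta> :: complex where "\<zeta> = of_real r"
  have "r > 0" using r(1) \<open>sqrt a > 0\<close> by auto
  then have ne: "\<zeta> \<noteq> - \<zeta>" by (simp add: \<zeta>_def flip: of_real_minus)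
  have "r\<^sup>2 = 1 \<or> r\<^sup>2 = a" using r(1) a by auto
  then have "\<zeta>\<^sup>2 = 1 \<or> \<zeta>\<^sup>2 = of_real a" by (auto simp: \<zeta>_def simp flip: of_real_power)
  then have roots: "poly p \<zeta> = 0" "poly p (- \<zeta>) = 0" by (auto simp: poly_p)
  \<comment> \<open>The set of free critical points is symmetric under negation, which exchanges the
    two basins.\<close>
  have crit_m: "Fin w \<notin> basin C (Fin (- \<zeta>))" if "w \<in> crit" for w
  proof
    assume "Fin w \<in> basin C (Fin (- \<zeta>))"
    then have "Fin (- w) \<in> basin C (Fin \<zeta>)" using basin_uminus by fastforce
    moreover have "- w \<in> crit" using that by (simp add: crit_def)
    ultimately show False using r(2) by (simp add: \<zeta>_def)
  qed
  let ?A = "immediate_basin C (Fin \<zeta>)" and ?B = "immediate_basin C (Fin (- \<zeta>))"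
  have sc: "simply_connected ?A" "simply_connected ?B"
    using simply_connected_immediate_basin_root roots crit_m r(2) by (simp_all add: \<zeta>_def)
  \<comment> \<open>The set to be counted consists of basins rather than roots. Distinctness holds
    because \<zeta>, being fixed, does not converge to its negative.\<close>
  have "?A \<noteq> ?B"
  proof
    assume eq: "?A = ?B"
    have "Fin \<zeta> \<in> ?A"
      using attracting_fixpoint.fixpoint_in_immediate_basin[OF attracting_fixpoint_root[OF roots(1)]] .
    then have "Fin \<zeta> \<in> basin C (Fin (- \<zeta>))"
      using eq attracting_fixpoint.immediate_basin_subset_basin[OF attracting_fixpoint_root[OF roots(2)]] by blast
    then show False
      using fixpoint_in_basin_iff[of C "Fin \<zeta>"] C_root[OF roots(1)] ne by simp
  qed
  then have "2 = card {?A, ?B}" by simp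
  also have "\<dots> \<le> card {B. (\<exists>\<zeta>\<in>{z. poly p z = 0}. B = immediate_basin C (Fin \<zeta>)) \<and> simply_connected B}"
  \<comment> \<open>Finiteness of the larger set matters, since \<open>card\<close> of an infinite
    set is 0; it follows from the finiteness of the set of roots.\<close>
  proof (rule card_mono)
    have "finite {z. poly p z = 0}" by (rule poly_roots_finite) (simp add: p_eq)
    then have "finite ((\<lambda>\<zeta>. immediate_basin C (Fin \<zeta>)) ` {z. poly p z = 0})" by (rule finite_imageI)
    then show "finite {B. (\<exists>\<zeta>\<in>{z. poly p z = 0}. B = immediate_basin C (Fin \<zeta>)) \<and> simply_connected B}"
      by (rule rev_finite_subset) auto
    show "{?A, ?B} \<subseteq> {B. (\<exists>\<zeta>\<in>{z. poly p z = 0}. B = immediate_basin C (Fin \<zeta>)) \<and> simply_connected B}"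
      using sc roots by auto
  qed
  finally show ?thesis .
qed

end

theorem theorem3p9:
  fixes a :: real
  assumes "0 < a" and "a < 1"
  defines "C \<equiv> chebyshev_method (quartic (complex_of_real a))"
  defines "roots \<equiv> {z. poly (quartic (complex_of_real a)) z = 0}"
  shows "card {B. (\<exists>\<zeta>\<in>roots. B = immediate_basin C (Fin \<zeta>)) \<and> simply_connected B} \<ge> 2"
proof -
  have quartic: "chebyshev_quartic a" using assms(1,2) by unfold_locales
  show ?thesis
    using chebyshev_quartic.two_simply_connected_basins[OF quartic]
    unfolding C_def roots_def chebyshev_quartic.C_def[OF quartic] .
qed

end
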